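(* Let $n,d\ge 1$, let $\mathcal{G}=\{\mathbf{G}_1,\dots,\mathbf{G}_l\}\subseteq \mathcal{S}_n(\mathbb{R}[X])$ be a finite set, and let $G=\{g_1,\dots,g_k\}\subseteq\mathbb{R}[X]$ be a finite set such that $\mathbf{K}_{\mathcal{G}}=K_G$ and $(T_G)^n\subseteq \mathcal{T}_{\mathcal{G}}$. Let $\mathbf{D}=D(d_1,\dots,d_r)$, $r\le n$, be an $n\times n$ diagonal matrix in $\mathcal{S}_n(\mathbb{R}[X])$. Then: (1) $\mathbf{D}\succ \mathbf{0}$ on $\mathbf{K}_{\mathcal{G}}$ if and only if there exist diagonal matrices $\mathbf{S}$ and $\mathbf{T}$ whose diagonal entries are in $T_G$ such that $\mathbf{S}\mathbf{D}=\mathbf{D}\mathbf{S}=\mathbf{I}_n+\mathbf{T}$. (2) $\mathbf{D}\succcurlyeq \mathbf{0}$ on $\mathbf{K}_{\mathcal{G}}$ if and only if there exist an integer $m\ge 0$ and diagonal matrices $\mathbf{S}$ and $\mathbf{T}$ whose diagonal entries are in $T_G$ such that $\mathbf{S}\mathbf{D}=\mathbf{D}\mathbf{S}=\mathbf{D}^{2m}+\mathbf{T}$. (3) $\mathbf{D}=\mathbf{0}$ on $\mathbf{K}_{\mathcal{G}}$ if and only if there exists an integer $m\ge 0$ such that $-\mathbf{D}^{2m}\in (T_G)^n$. (4) $\mathbf{K}_{\mathcal{G}}=\emptyset$ if and only if $-\mathbf{I}_n\in (T_G)^n$.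
   Context: $\mathbb{R}[X]=\mathbb{R}[x_1,\dots,x_d]$. For a commutative unital ring $R$, $\mathcal{M}_n(R)$ is the ring of $n\times n$ matrices over $R$, $\mathcal{S}_n(R)$ its subset of symmetric matrices, $\mathbf{I}_n$ the identity matrix. A quadratic module in $\mathcal{M}_n(R)$ is a set $\mathcal{M}\subseteq\mathcal{S}_n(R)$ with $\mathbf{I}_n\in\mathcal{M}$, $\mathcal{M}+\mathcal{M}\subseteq\mathcal{M}$, and $A^T\mathcal{M}A\subseteq\mathcal{M}$ for all $A\in\mathcal{M}_n(R)$. A preordering in $\mathcal{M}_n(R)$ is a quadratic module $\mathcal{T}$ such that $\mathcal{T}\cap(R\cdot\mathbf{I}_n)$ is closed under multiplication. $\mathcal{T}_{\mathcal{G}}$ denotes the smallest preordering in $\mathcal{M}_n(\mathbb{R}[X])$ containing $\mathcal{G}$. For $G\subseteq \mathbb{R}[X]$, $T_G$ denotes the smallest preordering of $\mathbb{R}[X]$ (the smallest subset closed under addition and multiplication and containing all squares) that contains $G$; for $G=\{g_1,\dots,g_k\}$ it is the set of all $\sum_{\sigma\in\{0,1\}^k}t_\sigma g_1^{\sigma_1}\cdots g_k^{\sigma_k}$ with each $t_\sigma$ a finite sum of squares in $\mathbb{R}[X]$. For a quadratic module $M\subseteq\mathbb{R}[X]$ (in particular $M=T_G$), $M^n$ denotes the set of all finite sums $\sum_i m_iA_i^TA_i$ with $m_i\in M$, $A_i\in\mathcal{M}_n(\mathbb{R}[X])$. $\mathbf{K}_{\mathcal{G}}=\{x\in\mathbb{R}^d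 : \mathbf{G}(x)\succcurlyeq\mathbf{0}\ \forall\,\mathbf{G}\in\mathcal{G}\}$ and $K_G=\{x\in\mathbb{R}^d: g(x)\ge 0\ \forall g\in G\}$. $D(d_1,\dots,d_r)$ is the $n\times n$ diagonal matrix with diagonal entries $d_1,\dots,d_r,0,\dots,0$. "$\mathbf{D}\succ\mathbf{0}$ (resp. $\succcurlyeq\mathbf 0$, $=\mathbf 0$) on a set" means that $\mathbf{D}(x)$ is positive definite (resp. positive semidefinite, zero) at each point $x$ of the set. *)

theory Defs
  imports "HOL-Library.Poly_Mapping" "Jordan_Normal_Form.Matrix"
begin

text \<open>The polynomial ring \<open>\<real>[x\<^sub>1,\<dots>,x\<^sub>d]\<close> is the monoid algebra of the exponent vectors
  \<open>'d \<Rightarrow>\<^sub>0 nat\<close>, with the variables indexed by a finite type \<open>'d\<close> (so \<open>d = CARD('d) \<ge> 1\<close>);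
  points of \<open>\<real>\<^sup>d\<close> are functions \<open>'d \<Rightarrow> real\<close>.\<close>

type_synonym 'd rpoly = "('d \<Rightarrow>\<^sub>0 nat) \<Rightarrow>\<^sub>0 real"

definition peval :: "('d::finite \<Rightarrow> real) \<Rightarrow> 'd rpoly \<Rightarrow> real" where
  "peval x p = (\<Sum>a\<in>Poly_Mapping.keys p.
     Poly_Mapping.lookup p a * (\<Prod>i\<in>UNIV. x i ^ Poly_Mapping.lookup a i))"

abbreviation mat_eval :: "('d::finite \<Rightarrow> real) \<Rightarrow> 'd rpoly mat \<Rightarrow> real mat" where
  "mat_eval x A \<equiv> map_mat (peval x) A"

definition preordering :: "'a::comm_ring_1 set \<Rightarrow> bool" where
  "preordering T \<longleftrightarrow>
     (\<forall>s\<in>T. \<forall>t\<in>T. s + t \<in> T) \<and> (\<forall>s\<in>T. \<forall>t\<in>T. s * t \<in> T) \<and> (\<forall>a. a\<^sup>2 \<in> T)"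

definition preordering_gen :: "'a::comm_ring_1 set \<Rightarrow> 'a set" where
  "preordering_gen G = \<Inter>{T. preordering T \<and> G \<subseteq> T}"

definition sym_mats :: "nat \<Rightarrow> 'a mat set" where
  "sym_mats n = {A \<in> carrier_mat n n. A\<^sup>T = A}"

definition mat_quadratic_module :: "nat \<Rightarrow> 'a::comm_ring_1 mat set \<Rightarrow> bool" where
  "mat_quadratic_module n M \<longleftrightarrow>
     M \<subseteq> sym_mats n \<and> 1\<^sub>m n \<in> M \<and> (\<forall>A\<in>M. \<forall>B\<in>M. A + B \<in> M) \<and>
     (\<forall>A\<in>carrier_mat n n. \<forall>B\<in>M. A\<^sup>T * B * A \<in> M)"

definition scalar_mats :: "nat \<Rightarrow> 'a::comm_ring_1 mat set" where
  "scalar_mats n = {c \<cdot>\<^sub>m 1\<^sub>m n | c. True}"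

definition mat_preordering :: "nat \<Rightarrow> 'a::comm_ring_1 mat set \<Rightarrow> bool" where
  "mat_preordering n T \<longleftrightarrow> mat_quadratic_module n T \<and>
     (\<forall>A \<in> T \<inter> scalar_mats n. \<forall>B \<in> T \<inter> scalar_mats n. A * B \<in> T \<inter> scalar_mats n)"

definition mat_preordering_gen :: "nat \<Rightarrow> 'a::comm_ring_1 mat set \<Rightarrow> 'a mat set" where
  "mat_preordering_gen n \<G> = \<Inter>{T. mat_preordering n T \<and> \<G> \<subseteq> T}"

text \<open>The set \<open>M\<^sup>n\<close> of all finite sums \<open>\<Sum>i. m\<^sub>i A\<^sub>i\<^sup>T A\<^sub>i\<close> with \<open>m\<^sub>i \<in> M\<close>. Matrices carry their
  dimension as a value, so there is no \<^const>\<open>sum\<close> for them and the sum is a fold over a list.\<close>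

definition qm_power :: "'a::comm_ring_1 set \<Rightarrow> nat \<Rightarrow> 'a mat set" where
  "qm_power M n = {foldr (\<lambda>(m, A) B. m \<cdot>\<^sub>m (A\<^sup>T * A) + B) ps (0\<^sub>m n n) | ps.
     set ps \<subseteq> M \<times> carrier_mat n n}"

definition psd_mat :: "nat \<Rightarrow> real mat \<Rightarrow> bool" where
  "psd_mat n A \<longleftrightarrow> A \<in> sym_mats n \<and> (\<forall>v\<in>carrier_vec n. 0 \<le> v \<bullet> (A *\<^sub>v v))"

definition pd_mat :: "nat \<Rightarrow> real mat \<Rightarrow> bool" where
  "pd_mat n A \<longleftrightarrow> A \<in> sym_mats n \<and> (\<forall>v\<in>carrier_vec n. v \<noteq> 0\<^sub>v n \<longrightarrow> 0 < v \<bullet> (A *\<^sub>v v))"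

definition K_mat :: "nat \<Rightarrow> 'd::finite rpoly mat set \<Rightarrow> ('d \<Rightarrow> real) set" where
  "K_mat n \<G> = {x. \<forall>A\<in>\<G>. psd_mat n (mat_eval x A)}"

definition K_set :: "'d::finite rpoly set \<Rightarrow> ('d \<Rightarrow> real) set" where
  "K_set G = {x. \<forall>g\<in>G. 0 \<le> peval x g}"

text \<open>The matrix \<open>D(d\<^sub>1,\<dots>,d\<^sub>r)\<close>, where \<open>ds = [d\<^sub>1,\<dots>,d\<^sub>r]\<close> and \<open>r \<le> n\<close>.\<close>

definition diag_of :: "nat \<Rightarrow> 'a::zero list \<Rightarrow> 'a mat" where
  "diag_of n ds = mat_diag n (\<lambda>i. if i < length ds then ds ! i else 0)"

definition diag_mats_over :: "nat \<Rightarrow> 'a::zero set \<Rightarrow> 'a mat set" where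
  "diag_mats_over n T = {S \<in> carrier_mat n n. diagonal_mat S \<and> (\<forall>i<n. S $$ (i, i) \<in> T)}"

end

theory Submission
  imports Defs "HOL-Computational_Algebra.Fraction_Field" "HOL-Algebra.Algebraic_Closure_Type"
    "Jordan_Normal_Form.Char_Poly"
begin

text \<open>
  All four statements reduce, entry by entry, to the Krivine--Stengle Positivstellensatz: if \<open>f\<close>
  vanishes on \<open>K\<^sub>G\<close>, then \<open>- f\<^sup>2\<^sup>m \<in> T\<^sub>G\<close> for some \<open>m\<close>; applied to \<open>G \<union> {- f}\<close> it yields the
  certificates for positive and for nonnegative \<open>f\<close>. If no \<open>- f\<^sup>2\<^sup>m\<close> lies in \<open>T\<^sub>G\<close>, a maximal
  preordering with this property is a prime cone \<open>P\<close> with \<open>f\<close> outside its support, and the residue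
  field of \<open>P\<close> embeds into a real closed field. By the Artin--Lang theorem the signs of the finitely
  many polynomials involved are realized at a real point, which is the point of \<open>K\<^sub>G\<close> with
  \<open>f \<noteq> 0\<close> that is excluded. The Artin--Lang theorem is proved by adding one variable at a time: the
  number of roots of a polynomial with prescribed signs of other polynomials is a combination of
  Cauchy indices, and the Euclidean algorithm expresses these through the signs of finitely many
  polynomials in the coefficients.\<close>

section \<open>Real closed fields\<close>

text \<open>The point sought is real, while the prime cone only gives a point over the real closure
  of its residue field, and no map from that field to the reals is at hand. Only the polynomial ring
  maps to both sides, and the signs of the images are all that can be compared; hence
  \<open>sg\<close> has integer values. In place of quantifier elimination,
  \<open>sign_specialization\<close> works along a filter on real points for which the sign of each
  single coefficient is eventually right. Counting roots shows that prescribed signs in one more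
  variable are then eventually realized, and an eventual statement rests on finitely many
  coefficient signs, exactly what an induction on the variables can supply. The real closure must be
  a type, whereas Zorn's lemma yields a set. It is cut out of the algebraic closure as the set of
  differences of a maximal cone, so that enlarging the cone enlarges the subfield and its ordering
  together. The scalar certificates come with a separate exponent for each diagonal entry, while the
  matrix statements ask for a single m; multiplying by even powers makes the exponents
  equal.\<close>

definition sg :: "'a::linordered_idom \<Rightarrow> int" where
  "sg x = (if x > 0 then 1 else if x < 0 then - 1 else 0)"

lemma sg_simps [simp]: "sg 0 = 0" "sg 1 = 1" "sg (- x) = - sg x"
  "sg x = 0 \<longleftrightarrow> x = 0" "sg x = 1 \<longleftrightarrow> x > 0" "sg x = - 1 \<longleftrightarrow> x < 0"
  by (auto simp: sg_def)

lemma sg_mult: "sg (x * y) = sg x * sg y"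
  by (auto simp: sg_def zero_less_mult_iff mult_less_0_iff)

lemma sg_power: "sg (x ^ n) = sg x ^ n"
  by (induction n) (auto simp: sg_mult)

lemma sg_mult_self [simp]: "x \<noteq> 0 \<Longrightarrow> sg x * sg x = 1"
  by (auto simp: sg_def)

text \<open>The constant \<open>poly\<close> cannot occur in a class axiom because of its sort constraint.\<close>

class rcf = linordered_field +
  assumes sum_IVT: "a < b \<Longrightarrow> (\<Sum>k\<le>n. f k * a ^ k) < 0 \<Longrightarrow> 0 < (\<Sum>k\<le>n. f k * b ^ k) \<Longrightarrow>
    \<exists>c. a < c \<and> c < b \<and> (\<Sum>k\<le>n. f k * c ^ k) = 0"

lemma poly_IVT_rcf:
  fixes p :: "'a::rcf poly"
  shows "a < b \<Longrightarrow> poly p a < 0 \<Longrightarrow> 0 < poly p b \<Longrightarrow> \<exists>c. a < c \<and> c < b \<and> poly p c = 0"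
  using sum_IVT[of a b "coeff p" "degree p"] by (simp add: poly_altdef)

lemma rcf_class_if_poly_IVT:
  assumes "\<And>p a b. a < b \<Longrightarrow> poly p a < 0 \<Longrightarrow> 0 < poly p b \<Longrightarrow>
    \<exists>c::'a::linordered_field. a < c \<and> c < b \<and> poly p c = 0"
  shows "OFCLASS('a, rcf_class)"
proof
  fix a b :: 'a and f :: "nat \<Rightarrow> 'a" and n
  have "poly (\<Sum>k\<le>n. monom (f k) k) x = (\<Sum>k\<le>n. f k * x ^ k)" for x
    by (simp add: poly_sum Polynomial.poly_monom)
  then show "a < b \<Longrightarrow> (\<Sum>k\<le>n. f k * a ^ k) < 0 \<Longrightarrow> 0 < (\<Sum>k\<le>n. f k * b ^ k) \<Longrightarrow>
    \<exists>c. a < c \<and> c < b \<and> (\<Sum>k\<le>n. f k * c ^ k) = 0"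
    using assms[of a b "\<Sum>k\<le>n. monom (f k) k"] by auto
qed

instance real :: rcf
  by (rule rcf_class_if_poly_IVT) (rule Polynomial.poly_IVT_pos)

lemma rcf_IVT:
  fixes p :: "'a::rcf poly"
  assumes "a < b" "sg (poly p a) \<noteq> sg (poly p b)" "poly p a \<noteq> 0" "poly p b \<noteq> 0"
  shows "\<exists>c. a < c \<and> c < b \<and> poly p c = 0"
  using assms poly_IVT_rcf[of a b p] poly_IVT_rcf[of a b "- p"]
  by (force simp: sg_def split: if_splits)

lemma sg_poly_const:
  fixes p :: "'a::rcf poly"
  assumes "a \<le> b" "\<And>c. a \<le> c \<Longrightarrow> c \<le> b \<Longrightarrow> poly p c \<noteq> 0"
  shows "sg (poly p a) = sg (poly p b)"
  using assms rcf_IVT[of a b p] by (metis less_le order_refl)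

text \<open>The uniform bound e > 0, stronger than positivity, carries the induction: if
  \<open>poly p x \<ge> e\<close> and x is at least (|a| + 1) / e, then \<open>x * poly p x\<close>
  outweighs the constant coefficient a.\<close>

lemma poly_pos_at_top:
  fixes p :: "'a::linordered_field poly"
  assumes "lead_coeff p > 0"
  shows "\<exists>b e. e > 0 \<and> (\<forall>x\<ge>b. poly p x \<ge> e)"
  using assms
proof (induction p)
  case (pCons a p)
  show ?case
  proof (cases "p = 0")
    case True
    then show ?thesis using pCons by (auto intro!: exI[of _ a])
  next
    case False
    then obtain b e where be: "e > 0" "\<And>x. x \<ge> b \<Longrightarrow> poly p x \<ge> e"
      using pCons by auto
    have "poly (pCons a p) x \<ge> 1" if x: "x \<ge> max b ((\<bar>a\<bar> + 1) / e)" for x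
    proof -
      have *: "(\<bar>a\<bar> + 1) / e \<ge> 0" using be by auto
      then have "x \<ge> 0" using x by (meson max.boundedE order.trans)
      have "\<bar>a\<bar> + 1 = (\<bar>a\<bar> + 1) / e * e" using be by auto
      also have "\<dots> \<le> x * poly p x"
        using x be(2)[of x] be(1) * \<open>x \<ge> 0\<close> by (intro mult_mono) auto
      finally show ?thesis by auto
    qed
    then show ?thesis by (intro exI[of _ "max b ((\<bar>a\<bar> + 1) / e)"] exI[of _ 1]) auto
  qed
qed simp

lemma sg_poly_at_top:
  fixes p :: "'a::linordered_field poly"
  shows "\<exists>b. \<forall>x\<ge>b. sg (poly p x) = sg (lead_coeff p)"
proof -
  consider "p = 0" | "lead_coeff p > 0" | "lead_coeff (- p) > 0"
    by (metis leading_coeff_neq_0 lead_coeff_minus linorder_neqE neg_0_less_iff_less)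
  then show ?thesis
  proof cases
    case 2
    then obtain b e where "e > 0" "\<forall>x\<ge>b. poly p x \<ge> e" using poly_pos_at_top by blast
    with 2 show ?thesis by (intro exI[of _ b]) (force simp: sg_def)
  next
    case 3
    then obtain b e where "e > 0" "\<forall>x\<ge>b. poly (- p) x \<ge> e" using poly_pos_at_top by blast
    with 3 show ?thesis by (intro exI[of _ b]) (force simp: sg_def)
  qed auto
qed

lemma sg_poly_at_bot:
  fixes p :: "'a::linordered_field poly"
  shows "\<exists>b. \<forall>x\<le>b. sg (poly p x) = (- 1) ^ degree p * sg (lead_coeff p)"
proof -
  let ?q = "pcompose p [:0, - 1:]"
  obtain b where b: "\<And>x. x \<ge> b \<Longrightarrow> sg (poly ?q x) = sg (lead_coeff ?q)"
    using sg_poly_at_top by blast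
  have lc: "sg (lead_coeff ?q) = (- 1) ^ degree p * sg (lead_coeff p)"
    by (subst lead_coeff_comp) (auto simp: sg_mult sg_power)
  have "sg (poly p x) = (- 1) ^ degree p * sg (lead_coeff p)" if "x \<le> - b" for x
    using b[of "- x"] that lc by (simp add: poly_pcompose)
  then show ?thesis by blast
qed

lemma sg_poly_beyond_roots:
  fixes p :: "'a::rcf poly"
  assumes "\<And>c. a \<le> c \<Longrightarrow> poly p c \<noteq> 0"
  shows "sg (poly p a) = sg (lead_coeff p)"
proof -
  obtain b where b: "\<And>x. x \<ge> b \<Longrightarrow> sg (poly p x) = sg (lead_coeff p)"
    using sg_poly_at_top by blast
  have "sg (poly p a) = sg (poly p (max a b))"
    using assms by (intro sg_poly_const) auto
  with b show ?thesis by simp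
qed

lemma sg_poly_before_roots:
  fixes p :: "'a::rcf poly"
  assumes "\<And>c. c \<le> a \<Longrightarrow> poly p c \<noteq> 0"
  shows "sg (poly p a) = (- 1) ^ degree p * sg (lead_coeff p)"
proof -
  obtain b where b: "\<And>x. x \<le> b \<Longrightarrow> sg (poly p x) = (- 1) ^ degree p * sg (lead_coeff p)"
    using sg_poly_at_bot by blast
  have "sg (poly p (min a b)) = sg (poly p a)"
    using assms by (intro sg_poly_const) auto
  with b show ?thesis by simp
qed

section \<open>One-sided signs and jumps\<close>

definition cofac :: "'a::field \<Rightarrow> 'a poly \<Rightarrow> 'a poly" where
  "cofac c p = p div [:- c, 1:] ^ order c p"

text \<open>For nonzero p this is the sign of p just to the right of c, see \<open>rsg_eq\<close>.
  Read off the cofactor it involves no neighbourhood of c and is visibly multiplicative.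
  \<open>lsg\<close> corrects it by the sign of (x - c)^k for x < c.\<close>

definition rsg :: "'a::linordered_field \<Rightarrow> 'a poly \<Rightarrow> int" where
  "rsg c p = sg (poly (cofac c p) c)"

definition lsg :: "'a::linordered_field \<Rightarrow> 'a poly \<Rightarrow> int" where
  "lsg c p = (- 1) ^ order c p * rsg c p"

lemma cofac_decomp: "p = [:- c, 1:] ^ order c p * cofac c p"
  by (metis cofac_def dvd_mult_div_cancel order_1)

lemma order_unique:
  fixes p :: "'a::field poly"
  assumes "p = [:- c, 1:] ^ k * q" "poly q c \<noteq> 0"
  shows "order c p = k" "cofac c p = q"
proof -
  have q: "q \<noteq> 0" using assms by auto
  have "order c p = order c ([:- c, 1:] ^ k) + order c q"
    using assms q by (metis order_mult mult_eq_0_iff power_eq_0_iff pCons_eq_0_iff one_neq_zero)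
  then show 1: "order c p = k" using assms by (simp add: order_power_n_n order_0I)
  show "cofac c p = q"
    unfolding cofac_def 1 by (subst assms(1), subst nonzero_mult_div_cancel_left) auto
qed

lemma poly_cofac_nonzero: "p \<noteq> 0 \<Longrightarrow> poly (cofac c p) c \<noteq> 0"
  using order_decomp[of p c] order_unique(2)[of p c] by (metis poly_eq_0_iff_dvd)

lemma rsg_mult:
  assumes "p \<noteq> 0" "q \<noteq> 0"
  shows "rsg c (p * q) = rsg c p * rsg c q"
proof -
  have "cofac c (p * q) = cofac c p * cofac c q"
  proof (rule order_unique(2))
    show "p * q = [:- c, 1:] ^ (order c p + order c q) * (cofac c p * cofac c q)"
      using cofac_decomp[of p c] cofac_decomp[of q c]
      by (metis (no_types, opaque_lifting) mult.assoc mult.left_commute power_add)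
  qed (use assms in \<open>simp add: poly_cofac_nonzero\<close>)
  then show ?thesis by (simp add: rsg_def sg_mult)
qed

lemma rsg_nonroot:
  assumes "poly p c \<noteq> 0"
  shows "rsg c p = sg (poly p c)" "lsg c p = sg (poly p c)"
  using order_unique[of p c 0 p] assms by (auto simp: rsg_def lsg_def)

lemma rsg_nonzero: "p \<noteq> 0 \<Longrightarrow> rsg c p \<noteq> 0"
  by (simp add: rsg_def poly_cofac_nonzero)

lemma rsg_unit: "p \<noteq> 0 \<Longrightarrow> rsg c p * rsg c p = 1"
  by (simp add: rsg_def poly_cofac_nonzero)

lemma poly_as_cofac: "poly p x = (x - c) ^ order c p * poly (cofac c p) x"
  by (subst cofac_decomp[of p c]) (simp add: algebra_simps)

lemma rsg_eq:
  fixes p :: "'a::rcf poly"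
  assumes "p \<noteq> 0" "c < y" "\<And>z. c < z \<Longrightarrow> z \<le> y \<Longrightarrow> poly p z \<noteq> 0"
  shows "sg (poly p y) = rsg c p"
proof -
  have "poly (cofac c p) z \<noteq> 0" if "c \<le> z" "z \<le> y" for z
    using assms that poly_cofac_nonzero[of p c] poly_as_cofac[of p z c] by (cases "z = c") auto
  then have "rsg c p = sg (poly (cofac c p) y)"
    unfolding rsg_def using assms by (intro sg_poly_const) auto
  moreover have "sg (y - c) = 1" using assms by simp
  ultimately show ?thesis unfolding poly_as_cofac[of p y c] sg_mult sg_power by (simp only:) simp
qed

lemma lsg_eq:
  fixes p :: "'a::rcf poly"
  assumes "p \<noteq> 0" "y < c" "\<And>z. y \<le> z \<Longrightarrow> z < c \<Longrightarrow> poly p z \<noteq> 0"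
  shows "sg (poly p y) = lsg c p"
proof -
  have "poly (cofac c p) z \<noteq> 0" if "y \<le> z" "z \<le> c" for z
    using assms that poly_cofac_nonzero[of p c] poly_as_cofac[of p z c] by (cases "z = c") auto
  then have "sg (poly (cofac c p) y) = rsg c p"
    unfolding rsg_def using assms by (intro sg_poly_const) auto
  moreover have "sg (y - c) = - 1" using assms by simp
  ultimately show ?thesis unfolding poly_as_cofac[of p y c] sg_mult sg_power lsg_def by (simp only:)
qed

definition jump :: "'a::linordered_field \<Rightarrow> 'a poly \<Rightarrow> int" where
  "jump c p = rsg c p - lsg c p"

lemma jump_altdef: "jump c p = (1 - (- 1) ^ order c p) * rsg c p"
  by (simp add: jump_def lsg_def algebra_simps)

lemma finite_order_less:
  assumes "p \<noteq> 0"
  shows "finite {c. order c q < order c p}"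
proof (rule finite_subset)
  show "{c. order c q < order c p} \<subseteq> {c. poly p c = 0}"
    using assms by (auto simp: order_root)
qed (use assms in \<open>simp add: poly_roots_finite\<close>)

text \<open>The sign of p changes only at roots, so the jumps add up to the sign at plus infinity
  minus the sign at minus infinity. Induction on the number of roots avoids listing them in order:
  the largest root c is split off with its multiplicity k, and at every other root the factor (x -
  c)^k has sign (- 1)^k.\<close>

lemma sum_jumps:
  fixes p :: "'a::rcf poly"
  assumes "p \<noteq> 0"
  shows "(\<Sum>c | poly p c = 0. jump c p) = sg (lead_coeff p) - (- 1) ^ degree p * sg (lead_coeff p)"
  using assms
proof (induction "card {c. poly p c = 0}" arbitrary: p)
  case 0
  then have "{c. poly p c = 0} = {}" using poly_roots_finite[of p] by simp
  then show ?case
    using sg_poly_beyond_roots[of 0 p] sg_poly_before_roots[of 0 p] by auto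
next
  case (Suc n)
  define Z where "Z = {c. poly p c = 0}"
  define c where "c = Max Z"
  have fin: "finite Z" unfolding Z_def using Suc.prems by (rule poly_roots_finite)
  have "Z \<noteq> {}" using Suc.hyps(2) unfolding Z_def[symmetric] by force
  then have cZ: "c \<in> Z" and c_max: "\<And>z. z \<in> Z \<Longrightarrow> z \<le> c"
    unfolding c_def using fin by auto
  define k where "k = order c p"
  define g where "g = cofac c p"
  have p: "p = [:- c, 1:] ^ k * g" unfolding k_def g_def by (rule cofac_decomp)
  have g0: "g \<noteq> 0" using p Suc.prems by auto
  have gc: "poly g c \<noteq> 0" using Suc.prems by (simp add: g_def poly_cofac_nonzero)
  have k: "k \<noteq> 0" using cZ gc by (auto simp: Z_def p)
  have roots: "{z. poly g z = 0} = Z - {c}" using gc k by (auto simp: Z_def p)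
  then have IH: "(\<Sum>z | poly g z = 0. jump z g) = sg (lead_coeff g) - (- 1) ^ degree g * sg (lead_coeff g)"
    using Suc.hyps(2) fin cZ g0 unfolding Z_def[symmetric] by (intro Suc.hyps(1)) auto
  have "jump z p = (- 1) ^ k * jump z g" if "z \<in> Z - {c}" for z
  proof -
    have z: "z < c" using that c_max by force
    have L: "poly ([:- c, 1:] ^ k) z \<noteq> 0" using z by simp
    have sgz: "sg (z - c) = - 1" using z by simp
    have "rsg z ([:- c, 1:] ^ k) = (- 1) ^ k"
      unfolding rsg_nonroot(1)[OF L] poly_power using sgz by (simp add: sg_power del: sg_simps)
    then have "rsg z p = (- 1) ^ k * rsg z g"
      unfolding p using g0 by (subst rsg_mult) auto
    moreover have "order z p = order z g"
      unfolding p using g0 L by (subst order_mult) (auto simp: order_0I simp del: poly_power)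
    ultimately show ?thesis by (simp add: jump_altdef)
  qed
  then have 1: "(\<Sum>z\<in>Z - {c}. jump z p) = (- 1) ^ k * (\<Sum>z | poly g z = 0. jump z g)"
    by (simp add: roots sum_distrib_left)
  have "rsg c p = sg (poly g c)" by (simp add: rsg_def g_def)
  also have "\<dots> = sg (lead_coeff g)"
  proof (rule sg_poly_beyond_roots)
    fix z assume "c \<le> z"
    show "poly g z \<noteq> 0"
    proof
      assume "poly g z = 0"
      then have "z \<in> Z" "z \<noteq> c" using roots by auto
      with c_max \<open>c \<le> z\<close> show False by force
    qed
  qed
  finally have 2: "jump c p = (1 - (- 1) ^ k) * sg (lead_coeff g)"
    by (simp add: jump_altdef k_def)
  have "lead_coeff p = lead_coeff ([:- c, 1:] ^ k) * lead_coeff g"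
    unfolding p by (rule lead_coeff_mult)
  also have "lead_coeff ([:- c, 1:] ^ k) = 1"
    unfolding lead_coeff_power by simp
  finally have 3: "sg (lead_coeff p) = sg (lead_coeff g)" "degree p = k + degree g"
    using g0 by (simp, simp add: p degree_mult_eq degree_power_eq)
  have "(\<Sum>z\<in>Z. jump z p) = jump c p + (\<Sum>z\<in>Z - {c}. jump z p)"
    using fin cZ by (simp add: sum.remove)
  also have "\<dots> = sg (lead_coeff p) - (- 1) ^ degree p * sg (lead_coeff p)"
    unfolding 1 2 IH 3(1) unfolding 3(2) by (simp add: power_add algebra_simps)
  finally show ?case by (simp add: Z_def)
qed

section \<open>Cauchy indices and Tarski queries\<close>

text \<open>Twice the usual Cauchy index of \<open>q / p\<close>. Common factors need not be cancelled: only the points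
  where \<open>p\<close> vanishes to higher order than \<open>q\<close> count.\<close>

definition cind :: "'a::linordered_field poly \<Rightarrow> 'a poly \<Rightarrow> int" where
  "cind q p = (if p = 0 \<or> q = 0 then 0 else \<Sum>c | order c q < order c p. jump c (p * q))"

lemma cind_0 [simp]: "cind 0 p = 0" "cind q 0 = 0"
  by (simp_all add: cind_def)

text \<open>Away from the roots of p and q, the product p * q has the sign of q / p and of p / q, so
  both indices sum jumps of the same polynomial, over disjoint sets of points. A common root with
  equal orders is a zero of even order of p * q and contributes no jump; \<open>sum_jumps\<close>
  gives the total.\<close>

lemma cind_reciprocity:
  fixes p :: "'a::rcf poly"
  assumes "p \<noteq> 0" "q \<noteq> 0"
  shows "cind q p + cind p q =
    sg (lead_coeff p * lead_coeff q) - (- 1) ^ (degree p + degree q) * sg (lead_coeff p * lead_coeff q)"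
proof -
  let ?A = "{c. order c q < order c p}" and ?B = "{c. order c p < order c q}"
  have pq: "p * q \<noteq> 0" using assms by simp
  have "cind q p + cind p q = (\<Sum>c\<in>?A \<union> ?B. jump c (p * q))"
    using assms by (subst sum.union_disjoint) (auto simp: finite_order_less cind_def mult.commute)
  also have "\<dots> = (\<Sum>c | poly (p * q) c = 0. jump c (p * q))"
  proof (rule sum.mono_neutral_left)
    show "finite {c. poly (p * q) c = 0}" using pq by (rule poly_roots_finite)
    show "?A \<union> ?B \<subseteq> {c. poly (p * q) c = 0}"
      using assms by (auto simp: order_root)
    show "\<forall>c\<in>{c. poly (p * q) c = 0} - (?A \<union> ?B). jump c (p * q) = 0"
    proof
      fix c assume "c \<in> {c. poly (p * q) c = 0} - (?A \<union> ?B)"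
      then have "order c p = order c q" by auto
      then have "order c (p * q) = 2 * order c p" using pq by (simp add: order_mult)
      then show "jump c (p * q) = 0" by (simp add: jump_altdef)
    qed
  qed
  finally show ?thesis
    using sum_jumps[OF pq] assms by (simp add: coeff_mult_degree_sum degree_mult_eq)
qed

text \<open>Where p vanishes to higher order than q, a multiple of p does not affect the lowest term
  of q in powers of X - c.\<close>

lemma order_add_multiple:
  fixes p q :: "'a::linordered_field poly"
  assumes "p \<noteq> 0" "q \<noteq> 0" "order c q < order c p"
  shows "q + a * p \<noteq> 0" "order c (q + a * p) = order c q" "rsg c (q + a * p) = rsg c q"
proof -
  let ?L = "[:- c, 1:]"
  obtain m where m: "order c p = order c q + Suc m"
    using assms(3) less_iff_Suc_add by (metis add_Suc_right)
  define u where "u = cofac c q + a * (?L ^ Suc m * cofac c p)"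
  have dec: "q + a * p = ?L ^ order c q * u"
    unfolding u_def distrib_left
    using cofac_decomp[of q c] cofac_decomp[of p c] unfolding m power_add
    by (metis (no_types, opaque_lifting) mult.assoc mult.left_commute)
  have uc: "poly u c = poly (cofac c q) c" by (simp add: u_def)
  have u0: "poly u c \<noteq> 0" unfolding uc using assms by (simp add: poly_cofac_nonzero)
  then show "q + a * p \<noteq> 0" unfolding dec by auto
  show "order c (q + a * p) = order c q" "rsg c (q + a * p) = rsg c q"
    using order_unique[OF dec u0] uc by (simp_all add: rsg_def)
qed

text \<open>Adding a polynomial to the quotient q / p does not alter its poles or their signs. This
  is the division step of the Euclidean algorithm for the index.\<close>

lemma cind_add_multiple:
  fixes p q :: "'a::linordered_field poly"
  shows "cind (q + a * p) p = cind q p"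
proof -
  consider "p = 0" | "p \<noteq> 0" "q = 0" | "p \<noteq> 0" "q \<noteq> 0" "q + a * p = 0"
    | "p \<noteq> 0" "q \<noteq> 0" "q + a * p \<noteq> 0" by blast
  then show ?thesis
  proof cases
    case 2
    have "\<not> order c (a * p) < order c p" if "a * p \<noteq> 0" for c
      using that by (simp add: order_mult)
    then show ?thesis using 2 by (auto simp: cind_def)
  next
    case 3
    then have "{c. order c q < order c p} = {}" using order_add_multiple(1)[of p q] by auto
    then show ?thesis using 3 by (simp add: cind_def)
  next
    case 4
    let ?r = "q + a * p"
    have q: "q = ?r + (- a) * p" by simp
    have eq: "order c ?r < order c p \<longleftrightarrow> order c q < order c p" for c
      using order_add_multiple(2)[of p q c a] order_add_multiple(2)[of p ?r c "- a"] 4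
      by (metis q)
    have "jump c (p * ?r) = jump c (p * q)" if "order c q < order c p" for c
      using order_add_multiple(2,3)[OF 4(1,2) that, of a] 4
      by (simp add: jump_altdef rsg_mult order_mult)
    then show ?thesis using 4 by (simp add: cind_def eq)
  qed auto
qed

lemma cind_smult:
  assumes "k > 0"
  shows "cind (smult k q) p = cind q p"
proof (cases "p = 0 \<or> q = 0")
  case False
  have "order c (smult k q) = order c q" for c
    using assms by (simp add: order_smult)
  moreover have "jump c (p * smult k q) = jump c (p * q)" for c
  proof -
    have "rsg c [:k:] = 1" using assms by (subst rsg_nonroot) auto
    moreover have "order c [:k:] = 0" using assms by (simp add: order_0I)
    moreover have "p * smult k q = [:k:] * (p * q)" by simp
    ultimately show ?thesis
      using assms False by (simp add: jump_altdef rsg_mult order_mult del: mult_pCons_left mult_smult_right)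
  qed
  ultimately show ?thesis using assms by (simp add: cind_def)
qed (auto)

lemma cind_const:
  assumes "degree p = 0"
  shows "cind q p = 0"
proof (cases "p = 0")
  case False
  then have "poly p c \<noteq> 0" for c
    using assms by (metis degree_eq_zeroE mult_zero_right poly_0 poly_pCons pCons_0_0 add.right_neutral)
  then have "order c p = 0" for c by (simp add: order_0I)
  then show ?thesis by (simp add: cind_def)
qed simp

lemma pderiv_at_root:
  fixes p :: "'a::linordered_field poly"
  assumes "p \<noteq> 0" "poly p c = 0"
  shows "pderiv p \<noteq> 0" "Suc (order c (pderiv p)) = order c p" "rsg c (pderiv p) = rsg c p"
proof -
  let ?L = "[:- c, 1:]"
  obtain k where k: "order c p = Suc k"
    using assms order_root[of p c] by (metis not0_implies_Suc)
  define u where "u = cofac c p"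
  define v where "v = smult (of_nat (Suc k)) u + ?L * pderiv u"
  have u: "poly u c \<noteq> 0" using assms by (simp add: u_def poly_cofac_nonzero)
  have p: "p = ?L ^ Suc k * u" using cofac_decomp[of p c] k u_def by simp
  have dec: "pderiv p = ?L ^ k * v"
    unfolding p v_def by (subst pderiv_mult, subst pderiv_power_Suc) (simp add: pderiv_pCons algebra_simps)
  have vc: "poly v c = of_nat (Suc k) * poly u c" by (simp add: v_def algebra_simps)
  have v0: "poly v c \<noteq> 0" unfolding vc using u by (simp del: of_nat_Suc)
  then show "pderiv p \<noteq> 0" unfolding dec by auto
  show "Suc (order c (pderiv p)) = order c p" using order_unique[OF dec v0] k by simp
  have "rsg c (pderiv p) = sg (of_nat (Suc k) * poly u c)"
    using order_unique[OF dec v0] vc by (simp add: rsg_def)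
  also have "sg (of_nat (Suc k) :: 'a) = 1" by (simp del: of_nat_Suc)
  then have "sg (of_nat (Suc k) * poly u c) = sg (poly u c)" unfolding sg_mult by (simp only: mult_1)
  finally show "rsg c (pderiv p) = rsg c p" by (simp add: rsg_def u_def)
qed

text \<open>The Sturm--Sylvester formula for the Tarski query of g on the roots of p. At a root c of
  p with g(c) nonzero, p and its derivative have the same sign on the right and orders differing by
  one, so their product with g has odd order and jumps by twice the sign of g(c), whatever the
  multiplicity of c.\<close>

lemma cind_pderiv:
  fixes p :: "'a::linordered_field poly"
  assumes "p \<noteq> 0"
  shows "cind (pderiv p * g) p = 2 * (\<Sum>c | poly p c = 0. sg (poly g c))"
proof (cases "pderiv p * g = 0")
  case True
  then have "sg (poly g c) = 0" if "poly p c = 0" for c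
    using pderiv_at_root(1)[OF assms that] by simp
  then show ?thesis unfolding True by simp
next
  case False
  have eq: "order c (pderiv p * g) < order c p \<longleftrightarrow> poly p c = 0 \<and> poly g c \<noteq> 0" for c
  proof (cases "poly p c = 0")
    case True
    with pderiv_at_root[OF assms True] False show ?thesis
      by (auto simp: order_mult order_root)
  qed (simp add: order_0I)
  have "jump c (p * (pderiv p * g)) = 2 * sg (poly g c)" if "poly p c = 0" "poly g c \<noteq> 0" for c
  proof -
    note d = pderiv_at_root[OF assms that(1)]
    have "order c g = 0" using that by (simp add: order_0I)
    then have "order c (p * (pderiv p * g)) = Suc (2 * order c (pderiv p))"
      using assms False d by (simp add: order_mult)
    moreover have "rsg c (p * (pderiv p * g)) = sg (poly g c)"
      using assms False d(3) rsg_unit[OF assms, of c] rsg_nonroot(1)[OF that(2)]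
      by (simp add: rsg_mult mult.assoc[symmetric])
    ultimately show ?thesis by (simp add: jump_altdef)
  qed
  then have "cind (pderiv p * g) p = (\<Sum>c | poly p c = 0 \<and> poly g c \<noteq> 0. 2 * sg (poly g c))"
    using assms False by (simp add: cind_def eq)
  also have "\<dots> = (\<Sum>c | poly p c = 0. 2 * sg (poly g c))"
    by (rule sum.mono_neutral_left) (auto simp: poly_roots_finite assms)
  finally show ?thesis by (simp add: sum_distrib_left)
qed

text \<open>Just right of a root, p and its derivative have equal signs; just left of a root,
  opposite ones. As p keeps its sign between a and b, the derivative cannot.\<close>

lemma Rolle_rcf:
  fixes p :: "'a::rcf poly"
  assumes "p \<noteq> 0" "a < b" "poly p a = 0" "poly p b = 0" "\<And>z. a < z \<Longrightarrow> z < b \<Longrightarrow> poly p z \<noteq> 0"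
  shows "\<exists>c. a < c \<and> c < b \<and> poly (pderiv p) c = 0"
proof (rule ccontr)
  assume no: "\<not> ?thesis"
  define m where "m = (a + b) / 2"
  have m: "a < m" "m < b" using assms by (auto simp: m_def)
  note da = pderiv_at_root[OF assms(1,3)] and db = pderiv_at_root[OF assms(1,4)]
  have n1: "poly (pderiv p) z \<noteq> 0" if "a < z" "z < b" for z using no that by blast
  have "sg (poly (pderiv p) m) = rsg a (pderiv p)"
    by (rule rsg_eq) (use da(1) m n1 in auto)
  moreover have "sg (poly (pderiv p) m) = lsg b (pderiv p)"
    by (rule lsg_eq) (use da(1) m n1 in auto)
  moreover have "sg (poly p m) = rsg a p"
    by (rule rsg_eq) (use assms m in auto)
  moreover have "sg (poly p m) = lsg b p"
    by (rule lsg_eq) (use assms m in auto)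
  moreover have "lsg b p = - lsg b (pderiv p)"
    using db(2,3)[symmetric] by (simp add: lsg_def)
  moreover have "rsg a p \<noteq> 0" using assms(1) by (rule rsg_nonzero)
  ultimately show False using da(3) by linarith
qed

section \<open>Specialization\<close>

lemma sg_eq_iff_degree:
  assumes "\<And>i. sg (coeff f i) = sg (coeff g i)"
  shows "degree f = degree g" "f = 0 \<longleftrightarrow> g = 0"
proof -
  have "coeff f i = 0 \<longleftrightarrow> coeff g i = 0" for i
    using assms[of i] by (metis sg_simps(4))
  then show "degree f = degree g" "f = 0 \<longleftrightarrow> g = 0"
    by (auto simp: degree_def poly_eq_iff)
qed

definition polys_over :: "'a::zero set \<Rightarrow> 'a poly set" where
  "polys_over B = {p. \<forall>i. coeff p i \<in> B}"

text \<open>For \<open>e, s \<in> {- 1, 0, 1}\<close> this polynomial in \<open>s\<close> is twice the indicator of \<open>s = e\<close>.\<close>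

definition sg_weight :: "int \<Rightarrow> int \<Rightarrow> int" where
  "sg_weight e s = (if e = 0 then 2 - 2 * s ^ 2 else e * s + s ^ 2)"

lemma sg_weight_sg: "sg_weight (sg x) (sg y) = (if sg x = sg y then 2 else 0)"
  by (simp add: sg_weight_def sg_def)

text \<open>The coefficient ring is a subset of a type because it grows with the set of variables
  during an induction.\<close>

locale ring_subset =
  fixes B :: "'a::comm_ring_1 set"
  assumes B_add: "\<And>a b. a \<in> B \<Longrightarrow> b \<in> B \<Longrightarrow> a + b \<in> B"
    and B_mult: "\<And>a b. a \<in> B \<Longrightarrow> b \<in> B \<Longrightarrow> a * b \<in> B"
    and B_uminus: "\<And>a. a \<in> B \<Longrightarrow> - a \<in> B"
    and B_0: "0 \<in> B" and B_1: "1 \<in> B"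
begin

lemma B_sum: "(\<And>i. i \<in> I \<Longrightarrow> f i \<in> B) \<Longrightarrow> sum f I \<in> B"
  by (induction I rule: infinite_finite_induct) (auto simp: B_0 B_add)

lemma B_diff: "a \<in> B \<Longrightarrow> b \<in> B \<Longrightarrow> a - b \<in> B"
  using B_add[of a "- b"] B_uminus by auto

lemma B_of_nat: "of_nat n \<in> B"
  by (induction n) (auto simp: B_0 B_1 B_add)

lemma over_coeff: "p \<in> polys_over B \<Longrightarrow> coeff p i \<in> B"
  by (simp add: polys_over_def)

lemma over_mult: "p \<in> polys_over B \<Longrightarrow> q \<in> polys_over B \<Longrightarrow> p * q \<in> polys_over B"
  by (auto simp: polys_over_def coeff_mult intro!: B_sum B_mult)

lemma over_add: "p \<in> polys_over B \<Longrightarrow> q \<in> polys_over B \<Longrightarrow> p + q \<in> polys_over B"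
  by (auto simp: polys_over_def intro!: B_add)

lemma over_diff: "p \<in> polys_over B \<Longrightarrow> q \<in> polys_over B \<Longrightarrow> p - q \<in> polys_over B"
  by (auto simp: polys_over_def intro!: B_diff)

lemma over_smult: "a \<in> B \<Longrightarrow> p \<in> polys_over B \<Longrightarrow> smult a p \<in> polys_over B"
  by (auto simp: polys_over_def intro!: B_mult)

lemma over_monom: "a \<in> B \<Longrightarrow> Polynomial.monom a n \<in> polys_over B"
  by (auto simp: polys_over_def B_0)

lemma over_1: "1 \<in> polys_over B"
  by (auto simp: polys_over_def B_0 B_1 coeff_1)

lemma over_prod_list: "(\<And>p. p \<in> set ps \<Longrightarrow> p \<in> polys_over B) \<Longrightarrow> prod_list ps \<in> polys_over B"
  by (induction ps) (auto simp: over_1 over_mult)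

end

text \<open>\<psi> is the target specialization and the \<phi> x are specializations that imitate
  it. The filter expresses "provided finitely many coefficient signs agree" without naming these
  coefficients; they would otherwise have to be collected from every division in the Euclidean
  algorithm.\<close>

locale sign_specialization = ring_subset B
  for B :: "'a::comm_ring_1 set" +
  fixes \<phi> :: "'x \<Rightarrow> 'a \<Rightarrow> 'r::rcf" and \<psi> :: "'a \<Rightarrow> 's::rcf" and F :: "'x filter"
  assumes hom_\<phi>: "\<And>x. comm_ring_hom (\<phi> x)" and hom_\<psi>: "comm_ring_hom \<psi>"
    and ev_sg: "\<And>a. a \<in> B \<Longrightarrow> \<forall>\<^sub>F x in F. sg (\<phi> x a) = sg (\<psi> a)"
begin

sublocale P: map_poly_comm_ring_hom "\<phi> x" for x
  using hom_\<phi> by (simp add: map_poly_comm_ring_hom_def)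

sublocale Q: map_poly_comm_ring_hom \<psi>
  using hom_\<psi> by (simp add: map_poly_comm_ring_hom_def)

abbreviation "P x \<equiv> map_poly (\<phi> x)"
abbreviation "Q \<equiv> map_poly \<psi>"

text \<open>\<^const>\<open>pderiv\<close> is only available over rings without zero divisors.\<close>

lemma over_pderiv:
  assumes "p \<in> polys_over B"
  shows "\<exists>d\<in>polys_over B. (\<forall>x. P x d = pderiv (P x p)) \<and> Q d = pderiv (Q p)"
proof
  define d where "d = (\<Sum>i\<le>degree p. Polynomial.monom (of_nat (Suc i) * coeff p (Suc i)) i)"
  have c: "coeff d i = of_nat (Suc i) * coeff p (Suc i)" for i
    by (auto simp: d_def coeff_sum coeff_eq_0 simp del: of_nat_Suc)
  show "d \<in> polys_over B"
    unfolding polys_over_def mem_Collect_eq c using assms by (auto intro!: B_mult B_of_nat over_coeff simp del: of_nat_Suc)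
  show "(\<forall>x. P x d = pderiv (P x p)) \<and> Q d = pderiv (Q p)"
    by (auto simp: poly_eq_iff coeff_pderiv c P.base.hom_mult Q.base.hom_mult P.base.hom_of_nat Q.base.hom_of_nat
        simp del: of_nat_Suc)
qed

lemma ev_coeffs:
  assumes "p \<in> polys_over B"
  shows "\<forall>\<^sub>F x in F. \<forall>i. sg (coeff (P x p) i) = sg (coeff (Q p) i)"
proof -
  have "\<forall>\<^sub>F x in F. \<forall>i\<in>{..degree p}. sg (\<phi> x (coeff p i)) = sg (\<psi> (coeff p i))"
    using assms by (intro eventually_ball_finite) (auto intro: ev_sg over_coeff)
  then show ?thesis
  proof eventually_elim
    case (elim x)
    then show ?case by (metis P.base.coeff_map_poly_hom Q.base.coeff_map_poly_hom P.base.hom_zero Q.base.hom_zero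
        atMost_iff coeff_eq_0 not_less sg_simps(1))
  qed
qed

lemma ev_degree:
  assumes "p \<in> polys_over B"
  shows "\<forall>\<^sub>F x in F. degree (P x p) = degree (Q p) \<and> (P x p = 0 \<longleftrightarrow> Q p = 0)
    \<and> sg (lead_coeff (P x p)) = sg (lead_coeff (Q p))"
  using ev_coeffs[OF assms]
proof eventually_elim
  case (elim x)
  from sg_eq_iff_degree[of "P x p" "Q p"] elim show ?case by simp
qed

text \<open>A Euclidean algorithm on the coefficients, with degrees measured after applying \<psi>.
  If f has the larger degree, pseudo-division lowers it; otherwise \<open>cind_reciprocity\<close>
  exchanges f and g, at the cost of a term that depends only on degrees and leading signs. For the
  imitating \<phi> x the same reduction preserves the index as soon as the image of b is nonzero,
  which holds eventually.\<close>

lemma ev_cind: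
  assumes "f \<in> polys_over B" "g \<in> polys_over B"
  shows "\<forall>\<^sub>F x in F. cind (P x f) (P x g) = cind (Q f) (Q g)"
  using assms
proof (induction "degree (Q f) + degree (Q g)" arbitrary: f g rule: less_induct)
  case less
  \<comment> \<open>Stated for fresh f and g since it is also applied to the exchanged pair.\<close>
  have key: "\<forall>\<^sub>F x in F. cind (P x f) (P x g) = cind (Q f) (Q g)"
    if fg: "f \<in> polys_over B" "g \<in> polys_over B" and n: "degree (Q f) + degree (Q g) = n"
      and le: "degree (Q g) \<le> degree (Q f)"
      and IH: "\<And>f' g'. degree (Q f') + degree (Q g') < n \<Longrightarrow> f' \<in> polys_over B \<Longrightarrow> g' \<in> polys_over B \<Longrightarrow>
        \<forall>\<^sub>F x in F. cind (P x f') (P x g') = cind (Q f') (Q g')" for f g n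
  proof -
    note ev = ev_degree[OF fg(1)] ev_degree[OF fg(2)]
    consider "Q f = 0" | "degree (Q g) = 0" | "Q f \<noteq> 0" "degree (Q g) > 0" by blast
    then show ?thesis
    proof cases
      case 1
      from ev(1) show ?thesis by eventually_elim (use 1 in auto)
    next
      case 2
      from ev(2) show ?thesis by eventually_elim (use 2 in \<open>auto simp: cind_const\<close>)
    next
      case 3
      define m k where "m = degree (Q f)" and "k = degree (Q g)"
      \<comment> \<open>These are the coefficients that become leading under \<psi>; the leading
        coefficients of f and g themselves may be mapped to zero. In \<open>f'\<close> the factor
        \<open>b * b\<close> replaces a division by b: it stays inside B, and being a square it
        leaves the index unchanged.\<close>
      define a b where "a = coeff f m" and "b = coeff g k"
      define f' where "f' = smult (b * b) f - Polynomial.monom (a * b) (m - k) * g"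
      have B: "a \<in> B" "b \<in> B" using fg by (auto simp: a_def b_def over_coeff)
      have f': "f' \<in> polys_over B"
        unfolding f'_def using fg B by (intro over_diff over_smult over_mult over_monom B_mult)
      have b0: "\<psi> b \<noteq> 0" using 3 by (auto simp: b_def k_def simp flip: Q.base.coeff_map_poly_hom)
      have Qf': "Q f' = smult (\<psi> b * \<psi> b) (Q f) - Polynomial.monom (\<psi> a * \<psi> b) (m - k) * Q g"
        unfolding f'_def by (simp add: hom_distribs)
      have Pf': "P x f' = smult (\<phi> x b * \<phi> x b) (P x f) - Polynomial.monom (\<phi> x a * \<phi> x b) (m - k) * P x g" for x
        unfolding f'_def by (simp add: hom_distribs)
      have m: "m > 0" "k \<le> m" using 3 le by (auto simp: m_def k_def)
      have "degree (Q f') < m"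
      proof -
        have 1: "degree (Polynomial.monom (\<psi> a * \<psi> b) (m - k) * Q g) \<le> m"
          using degree_mult_le[of "Polynomial.monom (\<psi> a * \<psi> b) (m - k)" "Q g"]
            degree_monom_le[of "\<psi> a * \<psi> b" "m - k"] m by (simp add: k_def)
        have 2: "degree (Q f') \<le> m"
          unfolding Qf' by (rule degree_diff_le) (use 1 in \<open>auto simp: m_def\<close>)
        have "coeff (Q f') m = \<psi> b * \<psi> b * \<psi> a - \<psi> a * \<psi> b * \<psi> b"
          unfolding Qf' using m by (simp add: coeff_monom_mult a_def b_def)
        then have "coeff (Q f') m = 0" by simp
        with 2 m(1) show ?thesis
          by (metis degree_0 le_neq_implies_less leading_coeff_0_iff)
      qed
      then have ev1: "\<forall>\<^sub>F x in F. cind (P x f') (P x g) = cind (Q f') (Q g)"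
        using n by (intro IH f' fg) (simp add: m_def)
      have red: "cind (smult (c * c) u - v * w) w = cind u w" if "c \<noteq> 0"
        for c :: "'c::linordered_field" and u v w
      proof -
        have "c * c > 0" using that by (metis not_real_square_gt_zero zero_less_mult_iff linorder_neqE)
        then show ?thesis
          using cind_add_multiple[of "smult (c * c) u" "- v" w] by (simp add: cind_smult)
      qed
      from ev1 ev_sg[OF B(2)] show ?thesis
      proof eventually_elim
        case (elim x)
        have "\<phi> x b \<noteq> 0" using elim(2) b0 by (metis sg_simps(4))
        then have "cind (P x f') (P x g) = cind (P x f) (P x g)" unfolding Pf' by (rule red)
        moreover have "cind (Q f') (Q g) = cind (Q f) (Q g)" using b0 unfolding Qf' by (rule red)
        ultimately show ?case using elim(1) by simp
      qed
    qed
  qed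
  show ?case
  proof (cases "degree (Q g) \<le> degree (Q f)")
    case True
    show ?thesis by (rule key[OF less.prems refl True]) (rule less.hyps)
  next
    case False
    have "\<forall>\<^sub>F x in F. cind (P x g) (P x f) = cind (Q g) (Q f)"
      by (rule key[OF less.prems(2,1) refl]) (use False less.hyps in \<open>auto simp: add.commute\<close>)
    with ev_degree[OF less.prems(1)] ev_degree[OF less.prems(2)] show ?thesis
    proof eventually_elim
      case (elim x)
      show ?case
      proof (cases "Q f = 0 \<or> Q g = 0")
        case False
        then have r: "cind (P x f) (P x g) + cind (P x g) (P x f) = sg (lead_coeff (P x g) * lead_coeff (P x f)) -
            (- 1) ^ (degree (P x g) + degree (P x f)) * sg (lead_coeff (P x g) * lead_coeff (P x f))"
          "cind (Q f) (Q g) + cind (Q g) (Q f) = sg (lead_coeff (Q g) * lead_coeff (Q f)) -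
            (- 1) ^ (degree (Q g) + degree (Q f)) * sg (lead_coeff (Q g) * lead_coeff (Q f))"
          using elim by (intro cind_reciprocity; simp)+
        have s: "sg (lead_coeff (P x g) * lead_coeff (P x f)) = sg (lead_coeff (Q g) * lead_coeff (Q f))"
          unfolding sg_mult using elim by metis
        have d: "degree (P x f) = degree (Q f)" "degree (P x g) = degree (Q g)" using elim by auto
        have "cind (P x f) (P x g) + cind (P x g) (P x f) = cind (Q f) (Q g) + cind (Q g) (Q f)"
          unfolding r s unfolding d ..
        then show ?thesis using elim(3) by simp
      qed (use elim in auto)
    qed
  qed
qed

lemma ev_query:
  assumes "p \<in> polys_over B" "g \<in> polys_over B" "Q p \<noteq> 0"
  shows "\<forall>\<^sub>F x in F. (\<Sum>c | poly (P x p) c = 0. sg (poly (P x g) c)) = (\<Sum>c | poly (Q p) c = 0. sg (poly (Q g) c))"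
proof -
  obtain d where d: "d \<in> polys_over B" "\<And>x. P x d = pderiv (P x p)" "Q d = pderiv (Q p)"
    using over_pderiv[OF assms(1)] by blast
  have "\<forall>\<^sub>F x in F. cind (P x (d * g)) (P x p) = cind (Q (d * g)) (Q p)"
    using assms d by (intro ev_cind over_mult)
  with ev_degree[OF assms(1)] show ?thesis
  proof eventually_elim
    case (elim x)
    have "P x p \<noteq> 0" using elim(1) assms(3) by blast
    have "P x (d * g) = pderiv (P x p) * P x g" "Q (d * g) = pderiv (Q p) * Q g"
      by (simp_all add: hom_distribs d)
    with elim(2) have "cind (pderiv (P x p) * P x g) (P x p) = cind (pderiv (Q p) * Q g) (Q p)" by argo
    then show ?case
      unfolding cind_pderiv[OF \<open>P x p \<noteq> 0\<close>] cind_pderiv[OF assms(3)] by linarith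
  qed
qed

text \<open>Each weight is a quadratic polynomial in a sign, so the product expands into plain
  Tarski queries of h times products of the g. The factor h is general because the expansion moves
  1, g or g * g into it.\<close>

lemma ev_weighted_query:
  assumes "p \<in> polys_over B" "Q p \<noteq> 0" "h \<in> polys_over B" "fst ` set gs \<subseteq> polys_over B"
  shows "\<forall>\<^sub>F x in F.
    (\<Sum>c | poly (P x p) c = 0. sg (poly (P x h) c) * (\<Prod>(g, e)\<leftarrow>gs. sg_weight e (sg (poly (P x g) c)))) =
    (\<Sum>c | poly (Q p) c = 0. sg (poly (Q h) c) * (\<Prod>(g, e)\<leftarrow>gs. sg_weight e (sg (poly (Q g) c))))"
  using assms(3,4)
proof (induction gs arbitrary: h)
  case Nil
  then show ?case using ev_query[OF assms(1) _ assms(2)] by simp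
next
  case (Cons ge gs)
  obtain g e where ge: "ge = (g, e)" by fastforce
  define \<alpha> \<beta> \<gamma> where "\<alpha> = (if e = 0 then 2 else 0 :: int)" and "\<beta> = e" and "\<gamma> = (if e = 0 then - 2 else 1 :: int)"
  have w: "sg_weight e s = \<alpha> + \<beta> * s + \<gamma> * (s * s)" for s
    by (simp add: sg_weight_def \<alpha>_def \<beta>_def \<gamma>_def power2_eq_square)
  have split: "(\<Sum>c\<in>R. s c * (sg_weight e (t c) * u c)) =
      \<alpha> * (\<Sum>c\<in>R. s c * u c) + \<beta> * (\<Sum>c\<in>R. (s c * t c) * u c) + \<gamma> * (\<Sum>c\<in>R. (s c * t c * t c) * u c)"
    for R :: "'c set" and s t u
    unfolding w sum_distrib_left sum.distrib[symmetric] by (rule sum.cong) (auto simp: algebra_simps)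
  have g: "g \<in> polys_over B" and gs: "fst ` set gs \<subseteq> polys_over B" using Cons.prems ge by auto
  note IH = Cons.IH[OF Cons.prems(1) gs] Cons.IH[OF over_mult[OF Cons.prems(1) g] gs]
    Cons.IH[OF over_mult[OF over_mult[OF Cons.prems(1) g] g] gs]
  from IH show ?case
  proof eventually_elim
    case (elim x)
    then show ?case by (simp add: ge split hom_distribs sg_mult)
  qed
qed

text \<open>With weights chosen for the signs at y, every root contributes 2 ^
  \<open>length gs\<close> if it has these signs and 0 otherwise. The root y makes the sum positive
  for \<psi>, hence eventually nonzero for \<phi> x, and some root there must contribute.\<close>

lemma ev_root_signs:
  assumes p: "p \<in> polys_over B" "Q p \<noteq> 0" "poly (Q p) y = 0" and gs: "set gs \<subseteq> polys_over B"
  shows "\<forall>\<^sub>F x in F. \<exists>z. poly (P x p) z = 0 \<and> (\<forall>g\<in>set gs. sg (poly (P x g) z) = sg (poly (Q g) y))"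
proof -
  define ges where "ges = map (\<lambda>g. (g, sg (poly (Q g) y))) gs"
  have ges: "fst ` set ges \<subseteq> polys_over B" using gs by (auto simp: ges_def)
  have prod: "(\<Prod>(g, e)\<leftarrow>ges. sg_weight e (sg (v g))) =
      (if \<forall>g\<in>set gs. sg (v g) = sg (poly (Q g) y) then 2 ^ length gs else 0)" for v :: "'a poly \<Rightarrow> 'c::linordered_idom"
    unfolding ges_def by (induction gs) (auto simp: sg_weight_sg)
  let ?S = "\<Sum>c | poly (Q p) c = 0. sg (poly (Q 1) c) * (\<Prod>(g, e)\<leftarrow>ges. sg_weight e (sg (poly (Q g) c)))"
  have "0 < ?S"
  proof (rule sum_pos2)
    show "finite {c. poly (Q p) c = 0}" using p by (simp add: poly_roots_finite)
    show "y \<in> {c. poly (Q p) c = 0}" using p by simp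
  qed (auto simp: prod)
  from ev_weighted_query[OF p(1,2) over_1 ges] show ?thesis
  proof eventually_elim
    case (elim x)
    with \<open>0 < ?S\<close> have "(\<Sum>c | poly (P x p) c = 0. sg (poly (P x 1) c) *
      (\<Prod>(g, e)\<leftarrow>ges. sg_weight e (sg (poly (P x g) c)))) \<noteq> 0" by linarith
    then obtain c where "poly (P x p) c = 0" "(\<Prod>(g, e)\<leftarrow>ges. sg_weight e (sg (poly (P x g) c))) \<noteq> 0"
      by (metis (mono_tags, lifting) mem_Collect_eq mult_zero_right sum.neutral)
    then show ?case unfolding prod by (metis (full_types))
  qed
qed

text \<open>To the right of all roots the signs are those of the leading coefficients, which
  specialize correctly; any sufficiently large z has them.\<close>

lemma ev_signs_above_roots:
  assumes gs: "set gs \<subseteq> polys_over B"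
    and y: "\<And>g c. g \<in> set gs \<Longrightarrow> Q g \<noteq> 0 \<Longrightarrow> y \<le> c \<Longrightarrow> poly (Q g) c \<noteq> 0"
  shows "\<forall>\<^sub>F x in F. \<exists>z. \<forall>g\<in>set gs. sg (poly (P x g) z) = sg (poly (Q g) y)"
proof -
  have "\<forall>\<^sub>F x in F. \<forall>g\<in>set gs. sg (lead_coeff (P x g)) = sg (lead_coeff (Q g))"
  proof (rule eventually_ball_finite)
    show "\<forall>g\<in>set gs. \<forall>\<^sub>F x in F. sg (lead_coeff (P x g)) = sg (lead_coeff (Q g))"
    proof
      fix g assume "g \<in> set gs"
      then have "g \<in> polys_over B" using gs by auto
      from ev_degree[OF this] show "\<forall>\<^sub>F x in F. sg (lead_coeff (P x g)) = sg (lead_coeff (Q g))"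
        by eventually_elim blast
    qed
  qed simp
  then show ?thesis
  proof eventually_elim
    case (elim x)
    have "\<forall>g. \<exists>b. \<forall>z\<ge>b. sg (poly (P x g) z) = sg (lead_coeff (P x g))"
      by (intro allI sg_poly_at_top)
    from choice[OF this] obtain b where b: "\<And>g z. z \<ge> b g \<Longrightarrow> sg (poly (P x g) z) = sg (lead_coeff (P x g))"
      by blast
    define z where "z = Max (insert 0 (b ` set gs))"
    have "sg (poly (P x g) z) = sg (poly (Q g) y)" if g: "g \<in> set gs" for g
    proof -
      have "b g \<le> z" using g by (auto simp: z_def)
      then have "sg (poly (P x g) z) = sg (lead_coeff (P x g))" by (rule b)
      also have "\<dots> = sg (lead_coeff (Q g))" using elim g by blast
      also have "\<dots> = sg (poly (Q g) y)"
      proof (cases "Q g = 0")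
        case False
        then show ?thesis using sg_poly_beyond_roots[of y "Q g"] y[OF g False] by simp
      qed simp
      finally show ?thesis .
    qed
    then show ?case by blast
  qed
qed

lemma ev_signs_below_roots:
  assumes gs: "set gs \<subseteq> polys_over B"
    and y: "\<And>g c. g \<in> set gs \<Longrightarrow> Q g \<noteq> 0 \<Longrightarrow> c \<le> y \<Longrightarrow> poly (Q g) c \<noteq> 0"
  shows "\<forall>\<^sub>F x in F. \<exists>z. \<forall>g\<in>set gs. sg (poly (P x g) z) = sg (poly (Q g) y)"
proof -
  let ?s = "\<lambda>p. (- 1) ^ degree p * sg (lead_coeff p)"
  have "\<forall>\<^sub>F x in F. \<forall>g\<in>set gs. ?s (P x g) = ?s (Q g)"
  proof (rule eventually_ball_finite)
    show "\<forall>g\<in>set gs. \<forall>\<^sub>F x in F. ?s (P x g) = ?s (Q g)"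
    proof
      fix g assume "g \<in> set gs"
      then have "g \<in> polys_over B" using gs by auto
      from ev_degree[OF this] show "\<forall>\<^sub>F x in F. ?s (P x g) = ?s (Q g)"
      proof eventually_elim
        case (elim x)
        then have "degree (P x g) = degree (Q g)" "sg (lead_coeff (P x g)) = sg (lead_coeff (Q g))"
          by blast+
        then show ?case by (rule arg_cong2[where f = "\<lambda>d s. (- 1) ^ d * s"])
      qed
    qed
  qed simp
  then show ?thesis
  proof eventually_elim
    case (elim x)
    have "\<forall>g. \<exists>b. \<forall>z\<le>b. sg (poly (P x g) z) = ?s (P x g)"
      by (intro allI sg_poly_at_bot)
    from choice[OF this] obtain b where b: "\<And>g z. z \<le> b g \<Longrightarrow> sg (poly (P x g) z) = ?s (P x g)"
      by blast
    define z where "z = Min (insert 0 (b ` set gs))"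
    have "sg (poly (P x g) z) = sg (poly (Q g) y)" if g: "g \<in> set gs" for g
    proof -
      have "z \<le> b g" using g by (auto simp: z_def)
      then have "sg (poly (P x g) z) = ?s (P x g)" by (rule b)
      also have "\<dots> = ?s (Q g)" using elim g by blast
      also have "\<dots> = sg (poly (Q g) y)"
      proof (cases "Q g = 0")
        case False
        then show ?thesis using sg_poly_before_roots[of y "Q g"] y[OF g False] by simp
      qed simp
      finally show ?thesis .
    qed
    then show ?case by blast
  qed
qed

text \<open>Everything is reduced to roots. If y is a root of some g, \<open>ev_root_signs\<close>
  applies to g. If y lies beyond all roots on one side, leading coefficients decide. Otherwise y
  lies in a bounded gap between roots of the product h, on which all signs are constant; by Rolle
  the gap contains a root c of the derivative of h, and c can stand in for y.\<close>

theorem ev_point_signs: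
  assumes gs: "set gs \<subseteq> polys_over B"
  shows "\<forall>\<^sub>F x in F. \<exists>z. \<forall>g\<in>set gs. sg (poly (P x g) z) = sg (poly (Q g) y)"
proof (cases "\<exists>g\<in>set gs. Q g \<noteq> 0 \<and> poly (Q g) y = 0")
  case True
  then obtain g where g: "g \<in> set gs" "Q g \<noteq> 0" "poly (Q g) y = 0" by blast
  then have "g \<in> polys_over B" using gs by auto
  from ev_root_signs[OF this g(2,3) gs] show ?thesis by eventually_elim blast
next
  case False
  \<comment> \<open>Polynomials vanishing identically under \<psi> have sign 0 everywhere; leaving
    them out keeps \<open>Q h\<close> nonzero.\<close>
  define h where "h = prod_list (filter (\<lambda>g. Q g \<noteq> 0) gs)"
  have h: "h \<in> polys_over B" unfolding h_def using gs by (intro over_prod_list) auto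
  have Qh: "Q h = prod_list (filter (\<lambda>q. q \<noteq> 0) (map Q gs))"
    unfolding h_def by (induction gs) (auto simp: hom_distribs)
  have h0: "Q h \<noteq> 0" unfolding Qh by (auto simp: prod_list_zero_iff)
  have hr: "poly (Q h) c = 0 \<longleftrightarrow> (\<exists>g\<in>set gs. Q g \<noteq> 0 \<and> poly (Q g) c = 0)" for c
    unfolding Qh by (induction gs) auto
  define Z where "Z = {c. poly (Q h) c = 0}"
  have fin: "finite Z" unfolding Z_def using h0 by (rule poly_roots_finite)
  have yZ: "y \<notin> Z" using False hr by (auto simp: Z_def)
  have neq: "c < y \<or> y < c" if "c \<in> Z" for c using yZ that by (cases c y rule: linorder_cases) auto
  consider "\<forall>c\<in>Z. c < y" | "\<forall>c\<in>Z. c > y" | "{c\<in>Z. c < y} \<noteq> {}" "{c\<in>Z. c > y} \<noteq> {}"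
    using neq by blast
  then show ?thesis
  proof cases
    case 1
    show ?thesis
    proof (rule ev_signs_above_roots[OF gs])
      fix g c assume g: "g \<in> set gs" "Q g \<noteq> 0" and c: "y \<le> c"
      have "c \<notin> Z" using 1 c by (meson not_le)
      then show "poly (Q g) c \<noteq> 0" using hr[of c] g by (auto simp: Z_def)
    qed
  next
    case 2
    show ?thesis
    proof (rule ev_signs_below_roots[OF gs])
      fix g c assume g: "g \<in> set gs" "Q g \<noteq> 0" and c: "c \<le> y"
      have "c \<notin> Z" using 2 c by (meson not_le)
      then show "poly (Q g) c \<noteq> 0" using hr[of c] g by (auto simp: Z_def)
    qed
  next
    case 3
    define a b where "a = Max {c\<in>Z. c < y}" and "b = Min {c\<in>Z. c > y}"
    have a: "a \<in> Z" "a < y" using Max_in[OF _ 3(1)] fin by (auto simp: a_def)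
    have b: "b \<in> Z" "y < b" using Min_in[OF _ 3(2)] fin by (auto simp: b_def)
    have noZ: "z \<notin> Z" if "a < z" "z < b" for z
    proof
      assume z: "z \<in> Z"
      with yZ consider "z < y" | "z > y" by force
      then show False
      proof cases
        case 1
        with z fin have "z \<le> a" by (auto simp: a_def)
        with that show False by simp
      next
        case 2
        with z fin have "b \<le> z" by (auto simp: b_def)
        with that show False by simp
      qed
    qed
    obtain c where c: "a < c" "c < b" "poly (pderiv (Q h)) c = 0"
    proof -
      have "a < b" using a(2) b(2) by (rule less_trans)
      moreover have "poly (Q h) a = 0" "poly (Q h) b = 0" using a(1) b(1) by (simp_all add: Z_def)
      moreover have "poly (Q h) z \<noteq> 0" if "a < z" "z < b" for z
        using noZ[OF that] by (simp add: Z_def)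
      ultimately show ?thesis using Rolle_rcf[OF h0] that by blast
    qed
    obtain d where d: "d \<in> polys_over B" "Q d = pderiv (Q h)"
      using over_pderiv[OF h] by blast
    have d0: "Q d \<noteq> 0" using pderiv_at_root(1)[OF h0, of a] a(1) unfolding d(2) Z_def by blast
    have same: "sg (poly (Q g) c) = sg (poly (Q g) y)" if g: "g \<in> set gs" for g
    proof (cases "Q g = 0")
      case False
      have nz: "poly (Q g) z \<noteq> 0" if "min c y \<le> z" "z \<le> max c y" for z
      proof -
        have "a < min c y" "max c y < b" using a(2) b(2) c(1,2) by simp_all
        then have "a < z" "z < b" using that by order+
        then have "z \<notin> Z" by (rule noZ)
        then have "poly (Q h) z \<noteq> 0" by (simp add: Z_def)
        then show ?thesis using hr[of z] False g by blast
      qed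
      show ?thesis
      proof (cases "c \<le> y")
        case True
        then show ?thesis by (intro sg_poly_const nz) simp_all
      next
        case False
        then have "sg (poly (Q g) y) = sg (poly (Q g) c)" by (intro sg_poly_const nz) simp_all
        then show ?thesis ..
      qed
    qed simp
    have "poly (Q d) c = 0" using c(3) d(2) by simp
    from ev_root_signs[OF d(1) d0 this gs] show ?thesis
    proof eventually_elim
      case (elim x)
      then obtain z where z: "\<forall>g\<in>set gs. sg (poly (P x g) z) = sg (poly (Q g) c)" by blast
      have "sg (poly (P x g) z) = sg (poly (Q g) y)" if "g \<in> set gs" for g
        using z[rule_format, OF that] same[OF that] by (rule trans)
      then show ?case by blast
    qed
  qed
qed

end

section \<open>Evaluation of polynomials\<close>

abbreviation monom_eval :: "('d::finite \<Rightarrow> real) \<Rightarrow> ('d \<Rightarrow>\<^sub>0 nat) \<Rightarrow> real" where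
  "monom_eval x a \<equiv> (\<Prod>i\<in>UNIV. x i ^ Poly_Mapping.lookup a i)"

abbreviation const_poly :: "real \<Rightarrow> 'd rpoly" where
  "const_poly c \<equiv> Poly_Mapping.single 0 c"

abbreviation var_poly :: "'d \<Rightarrow> 'd rpoly" where
  "var_poly i \<equiv> Poly_Mapping.single (Poly_Mapping.single i (Suc 0)) 1"

lemma peval_superset:
  assumes "finite A" "Poly_Mapping.keys p \<subseteq> A"
  shows "peval x p = (\<Sum>a\<in>A. Poly_Mapping.lookup p a * monom_eval x a)"
  unfolding peval_def by (rule sum.mono_neutral_left) (use assms in \<open>auto simp: in_keys_iff\<close>)

lemma peval_add: "peval x (p + q) = peval x p + peval x q"
proof -
  let ?A = "Poly_Mapping.keys p \<union> Poly_Mapping.keys q"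
  have "Poly_Mapping.keys (p + q) \<subseteq> ?A" by (rule Poly_Mapping.keys_add)
  then show ?thesis
    by (simp add: peval_superset[of ?A] lookup_add distrib_right sum.distrib)
qed

lemma peval_0 [simp]: "peval x 0 = 0"
  by (simp add: peval_def)

lemma peval_sum: "peval x (\<Sum>i\<in>I. f i) = (\<Sum>i\<in>I. peval x (f i))"
  by (induction I rule: infinite_finite_induct) (auto simp: peval_add)

lemma peval_single: "peval x (Poly_Mapping.single a c) = c * monom_eval x a"
  by (simp add: peval_def)

lemma poly_mapping_as_sum:
  fixes p :: "'a \<Rightarrow>\<^sub>0 'b::comm_monoid_add"
  shows "p = (\<Sum>a\<in>Poly_Mapping.keys p. Poly_Mapping.single a (Poly_Mapping.lookup p a))"
  by (rule poly_mapping_eqI) (auto simp: lookup_sum lookup_single when_def in_keys_iff)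

lemma peval_mult: "peval x (p * q) = peval x p * peval x q"
proof -
  have "p * q = (\<Sum>a\<in>Poly_Mapping.keys p. \<Sum>b\<in>Poly_Mapping.keys q. Poly_Mapping.single (a + b) (Poly_Mapping.lookup p a * Poly_Mapping.lookup q b))"
    by (subst (1 2) poly_mapping_as_sum) (simp add: sum_product mult_single)
  then have "peval x (p * q) = (\<Sum>a\<in>Poly_Mapping.keys p. \<Sum>b\<in>Poly_Mapping.keys q. Poly_Mapping.lookup p a * Poly_Mapping.lookup q b * monom_eval x (a + b))"
    by (simp add: peval_sum peval_single)
  also have "\<dots> = peval x p * peval x q"
    unfolding peval_def sum_product
    by (intro sum.cong refl) (simp add: lookup_add power_add prod.distrib algebra_simps)
  finally show ?thesis .
qed

lemma peval_hom: "comm_ring_hom (peval x)"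
proof
  show "peval x 1 = 1"
    using peval_single[of x 0 1] by simp
qed (auto simp: peval_add peval_mult)

lemma peval_const [simp]: "peval x (const_poly c) = c"
  by (simp add: peval_single)

lemma peval_var [simp]: "peval x (var_poly i) = x i"
proof -
  have "(\<Prod>j\<in>UNIV. x j ^ Poly_Mapping.lookup (Poly_Mapping.single i (Suc 0)) j) = (\<Prod>j\<in>UNIV. if j = i then x i else 1)"
    by (rule prod.cong) (auto simp: lookup_single when_def)
  then show ?thesis by (simp add: peval_single)
qed

section \<open>Polynomials in some of the variables\<close>

inductive_set coord_ring :: "'d set \<Rightarrow> 'd rpoly set" for V where
  const: "const_poly c \<in> coord_ring V"
| var: "i \<in> V \<Longrightarrow> var_poly i \<in> coord_ring V"
| add: "p \<in> coord_ring V \<Longrightarrow> q \<in> coord_ring V \<Longrightarrow> p + q \<in> coord_ring V"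
| mult: "p \<in> coord_ring V \<Longrightarrow> q \<in> coord_ring V \<Longrightarrow> p * q \<in> coord_ring V"

interpretation coord_ring: ring_subset "coord_ring V" for V
proof
  show "1 \<in> coord_ring V" using coord_ring.const[of 1] by simp
  show "0 \<in> coord_ring V" using coord_ring.const[of 0] by simp
  show "- a \<in> coord_ring V" if "a \<in> coord_ring V" for a
  proof -
    have "const_poly (- 1) * a = - a" by (simp add: single_uminus)
    then show ?thesis using coord_ring.mult[OF coord_ring.const[of "- 1"] that] by simp
  qed
qed (auto intro: coord_ring.intros)

lemma coord_ring_power: "p \<in> coord_ring V \<Longrightarrow> p ^ n \<in> coord_ring V"
  by (induction n) (auto intro: coord_ring.mult coord_ring.B_1)

lemma coord_ring_prod: "(\<And>i. i \<in> I \<Longrightarrow> f i \<in> coord_ring V) \<Longrightarrow> prod f I \<in> coord_ring V"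
  by (induction I rule: infinite_finite_induct) (auto intro: coord_ring.mult coord_ring.B_1)

lemma var_poly_power: "var_poly i ^ n = Poly_Mapping.single (Poly_Mapping.single i n) 1"
  by (induction n) (auto simp: mult_single simp flip: single_add)

lemma prod_var_poly:
  "finite I \<Longrightarrow> (\<Prod>i\<in>I. var_poly i ^ f i) = Poly_Mapping.single (\<Sum>i\<in>I. Poly_Mapping.single i (f i)) 1"
  by (induction I rule: finite_induct) (auto simp: mult_single var_poly_power)

lemma coord_ring_UNIV: "(p :: 'd::finite rpoly) \<in> coord_ring UNIV"
proof -
  have mon: "Poly_Mapping.single a c \<in> coord_ring UNIV" for a :: "'d \<Rightarrow>\<^sub>0 nat" and c
  proof -
    have "a = (\<Sum>i\<in>UNIV. Poly_Mapping.single i (Poly_Mapping.lookup a i))"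
      by (rule poly_mapping_eqI) (auto simp: lookup_sum lookup_single when_def)
    then have "Poly_Mapping.single a c = const_poly c * (\<Prod>i\<in>UNIV. var_poly i ^ Poly_Mapping.lookup a i)"
      by (simp add: prod_var_poly mult_single)
    then show ?thesis
      by (auto intro!: coord_ring.mult coord_ring.const coord_ring_prod coord_ring_power coord_ring.var)
  qed
  show ?thesis by (subst poly_mapping_as_sum) (intro coord_ring.B_sum mon)
qed

lemma peval_cong:
  assumes "p \<in> coord_ring V" "\<And>i. i \<in> V \<Longrightarrow> x i = y i"
  shows "peval x p = peval y p"
  using assms by induction (auto simp: peval_add peval_mult)

lemma coord_ring_insert:
  assumes "p \<in> coord_ring (insert i V)"
  shows "\<exists>P\<in>polys_over (coord_ring V). p = poly P (var_poly i)"
  using assms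
proof induction
  case (const c)
  have "[:const_poly c:] \<in> polys_over (coord_ring V)"
    by (auto simp: polys_over_def coeff_pCons coord_ring.const coord_ring.B_0 split: nat.splits)
  then show ?case by (intro bexI) auto
next
  case (var j)
  show ?case
  proof (cases "j = i")
    case True
    have "[:0, 1:] \<in> polys_over (coord_ring V)"
      by (auto simp: polys_over_def coeff_pCons coord_ring.B_1 coord_ring.B_0 split: nat.splits)
    then show ?thesis using True by (intro bexI) auto
  next
    case False
    with var have "[:var_poly j:] \<in> polys_over (coord_ring V)"
      by (auto simp: polys_over_def coeff_pCons coord_ring.var coord_ring.B_0 split: nat.splits)
    then show ?thesis by (intro bexI) auto
  qed
next
  case (add p q)
  then show ?case by (metis coord_ring.over_add poly_add)
next
  case (mult p q)
  then show ?case by (metis coord_ring.over_mult poly_mult)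
qed

text \<open>A positive real is an invertible square, and a homomorphism sends it to a nonzero
  square.\<close>

lemma sg_hom_const:
  fixes \<psi> :: "'d rpoly \<Rightarrow> 's::linordered_field"
  assumes "comm_ring_hom \<psi>"
  shows "sg (\<psi> (const_poly c)) = sg c"
proof -
  interpret comm_ring_hom \<psi> by fact
  have pos: "\<psi> (const_poly c) > 0" if "c > 0" for c
  proof -
    have "const_poly c = const_poly (sqrt c) * (const_poly (sqrt c) :: 'd rpoly)"
      using that by (simp add: mult_single)
    then have "\<psi> (const_poly c) = \<psi> (const_poly (sqrt c)) * \<psi> (const_poly (sqrt c))"
      by (metis hom_mult)
    moreover have "\<psi> (const_poly c) * \<psi> (const_poly (1 / c)) = 1"
      using that unfolding hom_mult[symmetric] mult_single by simp
    then have "\<psi> (const_poly c) \<noteq> 0" by auto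
    ultimately show ?thesis by (metis mult_eq_0_iff zero_less_mult_iff linorder_neqE)
  qed
  have "\<psi> (const_poly (- c)) = - \<psi> (const_poly c)"
    by (simp add: single_uminus hom_uminus)
  then show ?thesis using pos[of c] pos[of "- c"]
    by (cases c "0::real" rule: linorder_cases) (auto simp: sg_def)
qed

text \<open>This is the Artin--Lang theorem.\<close>

theorem real_point_of_sign_condition:
  fixes \<psi> :: "'d::finite rpoly \<Rightarrow> 's::rcf"
  assumes \<psi>: "comm_ring_hom \<psi>" and "finite \<F>"
  shows "\<exists>x. \<forall>f\<in>\<F>. sg (peval x f) = sg (\<psi> f)"
proof -
  have "\<exists>x. \<forall>f\<in>\<F>. sg (peval x f) = sg (\<psi> f)"
    if "finite V" "finite \<F>" "\<F> \<subseteq> coord_ring V" for V \<F>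
    using that
  proof (induction V arbitrary: \<F> rule: finite_induct)
    case empty
    have "\<exists>c. p = const_poly c" if "p \<in> coord_ring {}" for p :: "'d rpoly"
      using that by induction (auto simp: mult_single simp flip: single_add)
    then have "sg (peval (\<lambda>_. 0) f) = sg (\<psi> f)" if "f \<in> \<F>" for f
      using empty that sg_hom_const[OF \<psi>] by (metis peval_const subsetD)
    then show ?case by blast
  next
    case (insert i V)
    \<comment> \<open>The filter generated by the correct-sign sets of the polynomials in V. By
      \<open>eventually_INF\<close> an eventual property follows from finitely many of these
      conditions, and the induction hypothesis realizes them at one x.\<close>
    define Fi where "Fi = (INF a\<in>coord_ring V. principal {x. sg (peval x a) = sg (\<psi> a)})"
    interpret sign_specialization "coord_ring V" peval \<psi> Fi
    proof (rule sign_specialization.intro[OF coord_ring.ring_subset_axioms], rule sign_specialization_axioms.intro)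
      show "comm_ring_hom (peval x)" for x :: "'d \<Rightarrow> real" by (rule peval_hom)
      show "comm_ring_hom \<psi>" by fact
      show "\<forall>\<^sub>F x in Fi. sg (peval x a) = sg (\<psi> a)" if "a \<in> coord_ring V" for a
        unfolding Fi_def using that by (intro eventually_INF1) (auto simp: eventually_principal)
    qed
    obtain R where R: "\<And>f. f \<in> \<F> \<Longrightarrow> R f \<in> polys_over (coord_ring V)"
        "\<And>f. f \<in> \<F> \<Longrightarrow> f = poly (R f) (var_poly i)"
      using coord_ring_insert insert.prems(2) by (metis subsetD)
    obtain gs where gs: "set gs = R ` \<F>" using insert.prems(1) finite_list by (metis finite_imageI)
    have "\<forall>\<^sub>F x in Fi. \<exists>z. \<forall>g\<in>set gs. sg (poly (P x g) z) = sg (poly (Q g) (\<psi> (var_poly i)))"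
      by (rule ev_point_signs) (use R gs in auto)
    then have "\<exists>\<A>\<subseteq>coord_ring V. finite \<A> \<and> (\<forall>\<^sub>F x in (INF a\<in>\<A>. principal {x. sg (peval x a) = sg (\<psi> a)}).
         \<exists>z. \<forall>g\<in>set gs. sg (poly (P x g) z) = sg (poly (Q g) (\<psi> (var_poly i))))"
      unfolding Fi_def by (rule eventually_INF[THEN iffD1])
    then obtain \<A> where sA: "\<A> \<subseteq> coord_ring V" "finite \<A>"
      "\<forall>\<^sub>F x in (INF a\<in>\<A>. principal {x. sg (peval x a) = sg (\<psi> a)}).
         \<exists>z. \<forall>g\<in>set gs. sg (poly (P x g) z) = sg (poly (Q g) (\<psi> (var_poly i)))"
      by blast
    obtain x where x: "\<forall>f\<in>\<A>. sg (peval x f) = sg (\<psi> f)" using insert.IH[OF sA(2,1)] by blast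
    obtain z where z: "\<And>g. g \<in> set gs \<Longrightarrow> sg (poly (P x g) z) = sg (poly (Q g) (\<psi> (var_poly i)))"
      using sA(3) x unfolding INF_principal_finite[OF sA(2)] eventually_principal by blast
    have "sg (peval (x(i := z)) f) = sg (\<psi> f)" if f: "f \<in> \<F>" for f
    proof -
      \<comment> \<open>The coefficients of \<open>R f\<close> do not involve the variable i, so
        assigning z to it leaves them unchanged.\<close>
      have "P (x(i := z)) (R f) = P x (R f)"
      proof (rule poly_eqI)
        fix k
        have "coeff (R f) k \<in> coord_ring V" using R(1)[OF f] by (simp add: polys_over_def)
        then have "peval (x(i := z)) (coeff (R f) k) = peval x (coeff (R f) k)"
          by (rule peval_cong) (use insert.hyps in auto)
        then show "coeff (P (x(i := z)) (R f)) k = coeff (P x (R f)) k" by simp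
      qed
      moreover have "peval (x(i := z)) f = poly (P (x(i := z)) (R f)) (peval (x(i := z)) (var_poly i))"
        by (subst R(2)[OF f]) (rule P.base.poly_map_poly[symmetric])
      moreover have "\<psi> f = poly (Q (R f)) (\<psi> (var_poly i))"
        by (subst R(2)[OF f]) simp
      ultimately show ?thesis using z[of "R f"] f gs by simp
    qed
    then show ?case by blast
  qed
  from this[of UNIV \<F>] show ?thesis using assms coord_ring_UNIV by auto
qed

section \<open>Prime cones\<close>

lemma preordering_add: "preordering T \<Longrightarrow> a \<in> T \<Longrightarrow> b \<in> T \<Longrightarrow> a + b \<in> T"
  and preordering_mult: "preordering T \<Longrightarrow> a \<in> T \<Longrightarrow> b \<in> T \<Longrightarrow> a * b \<in> T"
  and preordering_square: "preordering T \<Longrightarrow> a\<^sup>2 \<in> T"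
  by (simp_all add: preordering_def)

lemma preordering_0: "preordering T \<Longrightarrow> 0 \<in> T" and preordering_1: "preordering T \<Longrightarrow> 1 \<in> T"
  using preordering_square[of T 0] preordering_square[of T 1] by simp_all

lemma preordering_even_power: "preordering T \<Longrightarrow> a ^ (2 * m) \<in> T"
  by (metis power_mult mult.commute preordering_square)

definition adjoin :: "'a::comm_ring_1 set \<Rightarrow> 'a \<Rightarrow> 'a set" where
  "adjoin T a = {t + a * s | t s. t \<in> T \<and> s \<in> T}"

text \<open>Since the square of a already lies in T, a product of two elements t + a * s has again
  this form.\<close>

lemma adjoin_preordering:
  assumes T: "preordering T"
  shows "preordering (adjoin T a)"
  unfolding preordering_def
proof (intro conjI ballI allI)
  fix x y assume "x \<in> adjoin T a" "y \<in> adjoin T a"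
  then obtain t s t' s' where xy: "x = t + a * s" "y = t' + a * s'"
    and mem: "t \<in> T" "s \<in> T" "t' \<in> T" "s' \<in> T"
    by (auto simp: adjoin_def)
  have "x + y = (t + t') + a * (s + s')"
    by (simp add: xy algebra_simps)
  then show "x + y \<in> adjoin T a"
    using mem T unfolding adjoin_def by (blast intro: preordering_add)
  have "x * y = (t * t' + a\<^sup>2 * (s * s')) + a * (t * s' + s * t')"
    by (simp add: xy algebra_simps power2_eq_square)
  moreover have "t * t' + a\<^sup>2 * (s * s') \<in> T" "t * s' + s * t' \<in> T"
    using mem T by (auto intro!: preordering_add preordering_mult preordering_square)
  ultimately show "x * y \<in> adjoin T a"
    unfolding adjoin_def by blast
next
  fix x :: 'a
  have "x\<^sup>2 = x\<^sup>2 + a * 0" by simp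
  then show "x\<^sup>2 \<in> adjoin T a"
    using T unfolding adjoin_def by (blast intro: preordering_square preordering_0)
qed

lemma adjoin_superset:
  assumes "preordering T"
  shows "T \<subseteq> adjoin T a" "a \<in> adjoin T a"
proof -
  have "t = t + a * 0" for t by simp
  then show "T \<subseteq> adjoin T a"
    using preordering_0[OF assms] unfolding adjoin_def by blast
  have "a = 0 + a * 1" by simp
  then show "a \<in> adjoin T a"
    using preordering_0[OF assms] preordering_1[OF assms] unfolding adjoin_def by blast
qed

definition support :: "'a::comm_ring_1 set \<Rightarrow> 'a set" where
  "support P = {a. a \<in> P \<and> - a \<in> P}"

text \<open>The points of the real spectrum: P consists of the elements that are nonnegative in an
  ordering of the residue domain modulo the prime ideal \<open>support P\<close>.\<close>

definition prime_cone :: "'a::comm_ring_1 set \<Rightarrow> bool" where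
  "prime_cone P \<longleftrightarrow> preordering P \<and> (\<forall>a. a \<in> P \<or> - a \<in> P) \<and> - 1 \<notin> P \<and>
     (\<forall>a b. a * b \<in> support P \<longrightarrow> a \<in> support P \<or> b \<in> support P)"

lemma support_mult:
  assumes P: "preordering P" and tot: "\<And>a. a \<in> P \<or> - a \<in> P" and a: "a \<in> support P"
  shows "b * a \<in> support P"
proof -
  from a have a': "a \<in> P" "- a \<in> P" by (simp_all add: support_def)
  from tot[of b] show ?thesis
  proof
    assume "b \<in> P"
    from preordering_mult[OF P this a'(1)] preordering_mult[OF P this a'(2)]
    show ?thesis by (simp add: support_def)
  next
    assume "- b \<in> P"
    from preordering_mult[OF P this a'(1)] preordering_mult[OF P this a'(2)]
    show ?thesis by (simp add: support_def)
  qed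
qed

text \<open>Zorn's lemma. The last clause is maximality in usable form: \<open>adjoin P a\<close> is
  strictly larger than P, so it contains some - f^(2m).\<close>

lemma maximal_preordering:
  assumes T: "preordering T" and f: "\<And>m. - (f ^ (2 * m)) \<notin> T"
  shows "\<exists>P. preordering P \<and> T \<subseteq> P \<and> (\<forall>m. - (f ^ (2 * m)) \<notin> P) \<and>
    (\<forall>a. a \<notin> P \<longrightarrow> (\<exists>m. \<exists>t\<in>P. \<exists>s\<in>P. - (f ^ (2 * m)) = t + a * s))"
proof -
  let ?A = "{P. preordering P \<and> T \<subseteq> P \<and> (\<forall>m. - (f ^ (2 * m)) \<notin> P)}"
  have "\<exists>P\<in>?A. \<forall>Y\<in>?A. P \<subseteq> Y \<longrightarrow> Y = P"
  proof (rule subset_Zorn_nonempty)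
    show "?A \<noteq> {}" using T f by blast
    fix C assume False: "C \<noteq> {}" and C: "subset.chain ?A C"
    then have CA: "C \<subseteq> ?A" and ch: "\<And>Y Z. Y \<in> C \<Longrightarrow> Z \<in> C \<Longrightarrow> Y \<subseteq> Z \<or> Z \<subseteq> Y"
      by (auto simp: subset.chain_def)
    show "\<Union>C \<in> ?A"
    proof -
      have pre: "preordering (\<Union>C)"
        unfolding preordering_def
      proof (intro conjI ballI allI)
        fix x y assume "x \<in> \<Union>C" "y \<in> \<Union>C"
        then obtain Y where Y: "Y \<in> C" "x \<in> Y" "y \<in> Y" using ch by blast
        then have "preordering Y" using CA by blast
        from preordering_add[OF this Y(2,3)] preordering_mult[OF this Y(2,3)] Y(1)
        show "x + y \<in> \<Union>C" "x * y \<in> \<Union>C" by blast+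
      next
        fix x :: 'a
        obtain Y where Y: "Y \<in> C" using False by blast
        then have "preordering Y" using CA by blast
        from preordering_square[OF this] Y show "x\<^sup>2 \<in> \<Union>C" by blast
      qed
      moreover have "T \<subseteq> \<Union>C" using False CA by blast
      moreover have "- (f ^ (2 * m)) \<notin> \<Union>C" for m using CA by blast
      ultimately show ?thesis by blast
    qed
  qed
  then obtain P where PA: "P \<in> ?A" and max: "\<forall>Y\<in>?A. P \<subseteq> Y \<longrightarrow> Y = P" by (rule bexE)
  then have P: "preordering P" "T \<subseteq> P" "\<forall>m. - (f ^ (2 * m)) \<notin> P" by simp_all
  have "\<exists>m. \<exists>t\<in>P. \<exists>s\<in>P. - (f ^ (2 * m)) = t + a * s" if "a \<notin> P" for a
  proof -
    note adj = adjoin_preordering[OF P(1), of a] adjoin_superset[OF P(1), of a]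
    have "adjoin P a \<noteq> P" using adj(3) that by blast
    then have "adjoin P a \<notin> ?A" using max adj(2) by blast
    moreover have "T \<subseteq> adjoin P a" using P(2) adj(2) by (rule subset_trans)
    ultimately have "\<not> (\<forall>m. - (f ^ (2 * m)) \<notin> adjoin P a)" using adj(1) by simp
    then obtain m where "- (f ^ (2 * m)) \<in> adjoin P a" by blast
    then obtain t s where "- (f ^ (2 * m)) = t + a * s" "t \<in> P" "s \<in> P"
      unfolding adjoin_def by blast
    then show ?thesis by blast
  qed
  with P show ?thesis by (intro exI[of _ P]) simp
qed

text \<open>All rests on \<open>contra\<close>: if - (a * b) is in P, then a or b is. Otherwise
  f^(2m) + t = - a * s and f^(2n) + t' = - b * s'; multiplying these equations puts - f^(2(m+n))
  into P. With b = - a this gives totality, because a * a is in P; applied to all choices of signs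
  of a and b it gives primality of the support.\<close>

theorem prime_cone_exists:
  assumes T: "preordering T" and f: "\<And>m. - (f ^ (2 * m)) \<notin> T"
  shows "\<exists>P. prime_cone P \<and> T \<subseteq> P \<and> f \<notin> support P"
proof -
  obtain P where P: "preordering P" "T \<subseteq> P" and fP: "\<And>m. - (f ^ (2 * m)) \<notin> P"
    and ext: "\<And>a. a \<notin> P \<Longrightarrow> \<exists>m. \<exists>t\<in>P. \<exists>s\<in>P. - (f ^ (2 * m)) = t + a * s"
    using maximal_preordering[OF assms] by blast
  note closed = preordering_add[OF P(1)] preordering_mult[OF P(1)] preordering_square[OF P(1)]
    preordering_even_power[OF P(1)]
  have contra: False if ab: "- (a * b) \<in> P" "a \<notin> P" "b \<notin> P" for a b
  proof -
    obtain m t s where 1: "t \<in> P" "s \<in> P" "- (f ^ (2 * m)) = t + a * s" using ext[OF ab(2)] by blast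
    obtain n t' s' where 2: "t' \<in> P" "s' \<in> P" "- (f ^ (2 * n)) = t' + b * s'" using ext[OF ab(3)] by blast
    let ?F = "f ^ (2 * m)" and ?G = "f ^ (2 * n)"
    have "?F + t = - (t + a * s) + t" "?G + t' = - (t' + b * s') + t'"
      unfolding 1(3)[symmetric] 2(3)[symmetric] by simp_all
    then have "?F + t = - (a * s)" "?G + t' = - (b * s')" by simp_all
    then have "(?F + t) * (?G + t') = (a * b) * (s * s')" by (simp add: ac_simps)
    then have h: "?F * ?G + (?F * t' + t * ?G + t * t') = (a * b) * (s * s')"
      by (simp add: algebra_simps)
    have "- (f ^ (2 * (m + n))) = - (?F * ?G)" by (simp add: distrib_left power_add)
    also have "\<dots> = ?F * t' + t * ?G + t * t' + (- (a * b)) * (s * s')"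
      unfolding mult_minus_left h[symmetric] by simp
    also have "\<dots> \<in> P" by (intro closed 1 2 ab(1))
    finally show False using fP by blast
  qed
  have tot: "a \<in> P \<or> - a \<in> P" for a
    using contra[of a "- a"] closed(3)[of a] unfolding mult_minus_right minus_minus power2_eq_square by blast
  have "a \<in> support P \<or> b \<in> support P" if ab: "a * b \<in> support P" for a b
  proof (rule ccontr)
    assume "\<not> ?thesis"
    then have "a \<notin> P \<or> - a \<notin> P" "b \<notin> P \<or> - b \<notin> P"
      by (simp_all add: support_def)
    moreover have "a * b \<in> P" "- (a * b) \<in> P" using ab by (simp_all add: support_def)
    ultimately show False
      using contra[of a b] contra[of a "- b"] contra[of "- a" b] contra[of "- a" "- b"]
      unfolding mult_minus_left mult_minus_right minus_minus by satx
  qed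
  moreover have "f \<notin> support P"
  proof
    assume "f \<in> support P"
    then have "- f * f \<in> P" by (intro closed(2)) (simp_all add: support_def)
    then show False using fP[of 1] by (simp add: power2_eq_square)
  qed
  moreover have "- 1 \<notin> P" using fP[of 0] by simp
  ultimately have "prime_cone P" using P tot unfolding prime_cone_def by simp
  with P(2) \<open>f \<notin> support P\<close> show ?thesis by blast
qed

section \<open>Real closures\<close>

text \<open>One set encodes a subfield of the ambient field, namely \<open>diffs P\<close>, together
  with a preordering of it. The condition on (a - b) * (a - b) says that squares of elements of this
  subfield lie in P.\<close>

definition field_cone :: "'a::field set \<Rightarrow> bool" where
  "field_cone P \<longleftrightarrow> (\<forall>a\<in>P. \<forall>b\<in>P. a + b \<in> P) \<and> (\<forall>a\<in>P. \<forall>b\<in>P. a * b \<in> P) \<and>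
     (\<forall>a\<in>P. inverse a \<in> P) \<and> (\<forall>a\<in>P. \<forall>b\<in>P. (a - b) * (a - b) \<in> P) \<and> 1 \<in> P \<and> - 1 \<notin> P"

definition diffs :: "'a::group_add set \<Rightarrow> 'a set" where
  "diffs P = {a - b | a b. a \<in> P \<and> b \<in> P}"

lemma field_coneD:
  assumes "field_cone P"
  shows "a \<in> P \<Longrightarrow> b \<in> P \<Longrightarrow> a + b \<in> P" "a \<in> P \<Longrightarrow> b \<in> P \<Longrightarrow> a * b \<in> P"
    "a \<in> P \<Longrightarrow> inverse a \<in> P" "x \<in> diffs P \<Longrightarrow> x * x \<in> P" "1 \<in> P" "- 1 \<notin> P" "0 \<in> P"
proof -
  have "(1 - 1) * (1 - 1 :: 'a) \<in> P" using assms unfolding field_cone_def by blast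
  then show "0 \<in> P" by simp
qed (use assms in \<open>auto simp: field_cone_def diffs_def\<close>)

lemma diffsI: "a \<in> P \<Longrightarrow> b \<in> P \<Longrightarrow> x = a - b \<Longrightarrow> x \<in> diffs P"
  by (auto simp: diffs_def)

lemma diffs_field:
  assumes P: "field_cone P"
  shows "x \<in> P \<Longrightarrow> x \<in> diffs P" "x \<in> diffs P \<Longrightarrow> y \<in> diffs P \<Longrightarrow> x + y \<in> diffs P"
    "x \<in> diffs P \<Longrightarrow> y \<in> diffs P \<Longrightarrow> x * y \<in> diffs P" "x \<in> diffs P \<Longrightarrow> - x \<in> diffs P"
    "x \<in> diffs P \<Longrightarrow> inverse x \<in> diffs P"
proof -
  note D = field_coneD[OF P]
  show 1: "x \<in> diffs P" if "x \<in> P" for x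
    by (rule diffsI[OF that D(7)]) simp
  show "x + y \<in> diffs P" if xy: "x \<in> diffs P" "y \<in> diffs P"
  proof -
    obtain a b c d where "x = a - b" "y = c - d" "a \<in> P" "b \<in> P" "c \<in> P" "d \<in> P"
      using xy unfolding diffs_def by blast
    then show ?thesis by (intro diffsI[of "a + c" _ "b + d"] D) auto
  qed
  show mult: "x * y \<in> diffs P" if xy: "x \<in> diffs P" "y \<in> diffs P" for x y
  proof -
    obtain a b c d where "x = a - b" "y = c - d" "a \<in> P" "b \<in> P" "c \<in> P" "d \<in> P"
      using xy unfolding diffs_def by blast
    then show ?thesis by (intro diffsI[of "a * c + b * d" _ "a * d + b * c"] D) (auto simp: algebra_simps)
  qed
  show "- x \<in> diffs P" if x: "x \<in> diffs P"
  proof -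
    obtain a b where "x = a - b" "a \<in> P" "b \<in> P" using x unfolding diffs_def by blast
    then show ?thesis by (intro diffsI[of b _ a]) auto
  qed
  show "inverse x \<in> diffs P" if x: "x \<in> diffs P"
  proof -
    \<comment> \<open>1 / x is x times 1 / x^2, and the second factor is in P.\<close>
    have "inverse (x * x) \<in> P" by (intro D x)
    then have "x * inverse (x * x) \<in> diffs P" by (intro mult x 1)
    then show ?thesis by (cases "x = 0") (simp_all add: field_simps)
  qed
qed

lemma field_cone_antisym:
  assumes P: "field_cone P" and "x \<in> P" "- x \<in> P"
  shows "x = 0"
proof (rule ccontr)
  assume "x \<noteq> 0"
  have "- x * inverse x \<in> P" using assms by (intro field_coneD[OF P])
  with \<open>x \<noteq> 0\<close> field_coneD(6)[OF P] show False by simp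
qed

definition cone_minus :: "'a::field set \<Rightarrow> 'a \<Rightarrow> 'a set" where
  "cone_minus P x = {p - x * q | p q. p \<in> P \<and> q \<in> P}"

lemma cone_minusI: "p \<in> P \<Longrightarrow> q \<in> P \<Longrightarrow> z = p - x * q \<Longrightarrow> z \<in> cone_minus P x"
  by (auto simp: cone_minus_def)

lemma cone_minusE:
  assumes "z \<in> cone_minus P x"
  obtains p q where "z = p - x * q" "p \<in> P" "q \<in> P"
  using assms unfolding cone_minus_def by blast

text \<open>As x is in \<open>diffs P\<close>, adjoining - x does not enlarge the subfield, so
  squares of differences are in P already. Inverses come from 1 / y = y * (1 / y)^2. If - 1 = p - x
  * q, then either q = 0 and - 1 is in P, or x = (1 + p) / q is in P.\<close>

lemma field_cone_minus:
  assumes P: "field_cone P" and x: "x \<in> diffs P" "x \<notin> P"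
  shows "field_cone (cone_minus P x)" (is "field_cone ?W")
proof -
  note D = field_coneD[OF P] and S = diffs_field[OF P]
  have PW: "p \<in> ?W" if "p \<in> P" for p by (rule cone_minusI[OF that D(7)]) simp
  have WS: "z \<in> diffs P" if "z \<in> ?W" for z
    using that
  proof (rule cone_minusE)
    fix p q assume "z = p - x * q" "p \<in> P" "q \<in> P"
    then show ?thesis using S(2)[OF S(1) S(4)[OF S(3)[OF x(1) S(1)]]] by simp
  qed
  have mult: "y * z \<in> ?W" if yz: "y \<in> ?W" "z \<in> ?W" for y z
  proof -
    obtain p q where y: "y = p - x * q" "p \<in> P" "q \<in> P" by (rule cone_minusE[OF yz(1)])
    obtain p' q' where z: "z = p' - x * q'" "p' \<in> P" "q' \<in> P" by (rule cone_minusE[OF yz(2)])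
    show ?thesis
    proof (rule cone_minusI)
      show "p * p' + (x * x) * (q * q') \<in> P" "p * q' + q * p' \<in> P"
        by (intro D y z x)+
    qed (simp add: y z algebra_simps)
  qed
  show ?thesis
    unfolding field_cone_def
  proof (intro conjI ballI)
    show "y + z \<in> ?W" if yz: "y \<in> ?W" "z \<in> ?W" for y z
    proof -
      obtain p q where y: "y = p - x * q" "p \<in> P" "q \<in> P" by (rule cone_minusE[OF yz(1)])
      obtain p' q' where z: "z = p' - x * q'" "p' \<in> P" "q' \<in> P" by (rule cone_minusE[OF yz(2)])
      show ?thesis
      proof (rule cone_minusI)
        show "p + p' \<in> P" "q + q' \<in> P" by (intro D y z)+
      qed (simp add: y z algebra_simps)
    qed
    show "y * z \<in> ?W" if "y \<in> ?W" "z \<in> ?W" for y z using that by (rule mult)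
    show "inverse y \<in> ?W" if y: "y \<in> ?W" for y
    proof -
      have "inverse y * inverse y \<in> ?W" by (rule PW[OF D(4)[OF S(5)[OF WS[OF y]]]])
      from mult[OF y this] have "y * (inverse y * inverse y) \<in> ?W" .
      moreover have "y * (inverse y * inverse y) = inverse y" by (cases "y = 0") auto
      ultimately show ?thesis by (simp only:)
    qed
    show "(y - z) * (y - z) \<in> ?W" if "y \<in> ?W" "z \<in> ?W" for y z
      using D(4)[OF S(2)[OF WS[OF that(1)] S(4)[OF WS[OF that(2)]]]] PW by simp
    show "1 \<in> ?W" by (intro PW D)
    show "- 1 \<notin> ?W"
    proof
      assume "- 1 \<in> ?W"
      then obtain p q where *: "- 1 = p - x * q" "p \<in> P" "q \<in> P" by (rule cone_minusE)
      show False
      proof (cases "q = 0")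
        case True
        then show ?thesis using * D(6) by simp
      next
        case False
        have "x * q = 1 + p" using *(1) by (simp add: algebra_simps)
        then have "x = (1 + p) * inverse q" using False by (simp add: field_simps)
        also have "\<dots> \<in> P" by (intro D *)
        finally show False using x by blast
      qed
    qed
  qed
qed

definition maximal_cone :: "'a::field set \<Rightarrow> bool" where
  "maximal_cone P \<longleftrightarrow> field_cone P \<and> (\<forall>W. field_cone W \<longrightarrow> P \<subseteq> W \<longrightarrow> W = P)"

lemma maximal_coneD:
  assumes "maximal_cone P"
  shows "field_cone P" "field_cone W \<Longrightarrow> P \<subseteq> W \<Longrightarrow> W = P"
  using assms unfolding maximal_cone_def by blast+

lemma maximal_cone_total:
  assumes P: "maximal_cone P" and x: "x \<in> diffs P"
  shows "x \<in> P \<or> - x \<in> P"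
proof (cases "x \<in> P")
  case False
  note FP = maximal_coneD(1)[OF P]
  note D = field_coneD[OF FP]
  have "P \<subseteq> cone_minus P x"
  proof
    fix p assume "p \<in> P"
    then show "p \<in> cone_minus P x" by (rule cone_minusI[OF _ D(7)]) simp
  qed
  with field_cone_minus[OF FP x False] have "cone_minus P x = P" by (rule maximal_coneD(2)[OF P])
  moreover have "- x \<in> cone_minus P x"
    by (rule cone_minusI[OF D(7,5)]) simp
  ultimately show ?thesis by blast
qed simp

lemma maximal_cone_exists:
  assumes P0: "field_cone P0"
  shows "\<exists>P. maximal_cone P \<and> P0 \<subseteq> P"
proof -
  let ?A = "{P. field_cone P \<and> P0 \<subseteq> P}"
  have "\<exists>P\<in>?A. \<forall>W\<in>?A. P \<subseteq> W \<longrightarrow> W = P"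
  proof (rule subset_Zorn_nonempty)
    show "?A \<noteq> {}" using P0 by blast
    fix C assume C0: "C \<noteq> {}" and C: "subset.chain ?A C"
    from C have CA: "\<And>Y. Y \<in> C \<Longrightarrow> field_cone Y \<and> P0 \<subseteq> Y"
      and ch: "\<And>Y Z. Y \<in> C \<Longrightarrow> Z \<in> C \<Longrightarrow> Y \<subseteq> Z \<or> Z \<subseteq> Y"
      unfolding subset_chain_def by blast+
    obtain Y0 where Y0: "Y0 \<in> C" using C0 by blast
    have "field_cone (\<Union>C)"
      unfolding field_cone_def
    proof (intro conjI ballI)
      fix x y assume "x \<in> \<Union>C" "y \<in> \<Union>C"
      then obtain Y where Y: "Y \<in> C" "x \<in> Y" "y \<in> Y" using ch by blast
      then have F: "field_cone Y" using CA by blast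
      have "x + y \<in> Y" "x * y \<in> Y" "(x - y) * (x - y) \<in> Y"
        using F Y unfolding field_cone_def by blast+
      then show "x + y \<in> \<Union>C" "x * y \<in> \<Union>C" "(x - y) * (x - y) \<in> \<Union>C" using Y by blast+
    next
      fix x assume "x \<in> \<Union>C"
      then obtain Y where Y: "Y \<in> C" "x \<in> Y" by blast
      then have "inverse x \<in> Y" using CA field_coneD(3) by blast
      then show "inverse x \<in> \<Union>C" using Y by blast
    next
      show "1 \<in> \<Union>C" using Y0 CA[OF Y0] field_coneD(5) by blast
      show "- 1 \<notin> \<Union>C" using CA field_coneD(6) by blast
    qed
    moreover have "P0 \<subseteq> \<Union>C" using Y0 CA[OF Y0] by blast
    ultimately show "\<Union>C \<in> ?A" by blast
  qed
  then obtain P where "P \<in> ?A" and max: "\<forall>W\<in>?A. P \<subseteq> W \<longrightarrow> W = P" by (rule bexE)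
  then have P: "field_cone P" "P0 \<subseteq> P" by simp_all
  have "W = P" if "field_cone W" "P \<subseteq> W" for W
    using max that P(2) by simp
  then have "maximal_cone P" using P(1) unfolding maximal_cone_def by blast
  with P(2) show ?thesis by blast
qed

section \<open>A real closure inside the algebraic closure\<close>

definition rc_pos :: "'a::linordered_field alg_closure set" where
  "rc_pos = (SOME P. maximal_cone P \<and> to_ac ` {0..} \<subseteq> P)"

lemma rc_pos: "maximal_cone (rc_pos :: 'a::linordered_field alg_closure set)"
    "to_ac ` {0..} \<subseteq> (rc_pos :: 'a alg_closure set)"
proof -
  have "field_cone (to_ac ` {0 :: 'a..})"
    unfolding field_cone_def
  proof (intro conjI ballI)
    fix x y :: "'a alg_closure"
    assume "x \<in> to_ac ` {0..}" "y \<in> to_ac ` {0..}"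
    then obtain a b where [simp]: "x = to_ac a" "y = to_ac b" and ab: "a \<ge> 0" "b \<ge> 0" by auto
    show "x + y \<in> to_ac ` {0..}"
      using ab by (intro image_eqI[of _ _ "a + b"]) auto
    show "x * y \<in> to_ac ` {0..}"
      using ab by (intro image_eqI[of _ _ "a * b"]) auto
    show "(x - y) * (x - y) \<in> to_ac ` {0..}"
      by (intro image_eqI[of _ _ "(a - b) * (a - b)"]) auto
  next
    fix x :: "'a alg_closure"
    assume "x \<in> to_ac ` {0..}"
    then obtain a where "x = to_ac a" "a \<ge> 0" by auto
    then show "inverse x \<in> to_ac ` {0..}"
      by (intro image_eqI[of _ _ "inverse a"]) auto
  next
    show "(1 :: 'a alg_closure) \<in> to_ac ` {0..}" by (intro image_eqI[of _ _ 1]) auto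
    show "(- 1 :: 'a alg_closure) \<notin> to_ac ` {0..}"
    proof
      assume "(- 1 :: 'a alg_closure) \<in> to_ac ` {0..}"
      then obtain a :: 'a where a: "to_ac a = - 1" "a \<ge> 0" by force
      have "to_ac a = to_ac (- 1 :: 'a)" unfolding a by simp
      then have "a = - 1" unfolding to_ac_eq_iff .
      with a show False by simp
    qed
  qed
  from someI_ex[OF maximal_cone_exists[OF this]]
  show "maximal_cone (rc_pos :: 'a alg_closure set)" "to_ac ` {0..} \<subseteq> (rc_pos :: 'a alg_closure set)"
    unfolding rc_pos_def by simp_all
qed

lemma rc_pos_field_cone: "field_cone rc_pos"
  by (rule maximal_coneD(1)[OF rc_pos(1)])

lemmas rc_posD = field_coneD[OF rc_pos_field_cone]
lemmas rc_diffs = diffs_field[OF rc_pos_field_cone]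

text \<open>The subfield belonging to the maximal cone. The ambient algebraic closure supplies a
  root for every nonconstant polynomial over it, which is how maximality is exploited below.\<close>

typedef (overloaded) 'a rc = "diffs (rc_pos :: 'a::linordered_field alg_closure set)"
  using rc_diffs(1)[OF rc_posD(7)] by blast

setup_lifting type_definition_rc

instantiation rc :: (linordered_field) linordered_field
begin

lift_definition zero_rc :: "'a rc" is 0 by (intro rc_diffs(1) rc_posD)
lift_definition one_rc :: "'a rc" is 1 by (intro rc_diffs(1) rc_posD)
lift_definition plus_rc :: "'a rc \<Rightarrow> 'a rc \<Rightarrow> 'a rc" is "(+)" by (rule rc_diffs)
lift_definition times_rc :: "'a rc \<Rightarrow> 'a rc \<Rightarrow> 'a rc" is "(*)" by (rule rc_diffs)
lift_definition uminus_rc :: "'a rc \<Rightarrow> 'a rc" is uminus by (rule rc_diffs)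
lift_definition minus_rc :: "'a rc \<Rightarrow> 'a rc \<Rightarrow> 'a rc" is "(-)"
  using rc_diffs(2)[OF _ rc_diffs(4)] by simp
lift_definition inverse_rc :: "'a rc \<Rightarrow> 'a rc" is inverse by (rule rc_diffs)
lift_definition divide_rc :: "'a rc \<Rightarrow> 'a rc \<Rightarrow> 'a rc" is "(/)"
  unfolding divide_inverse by (rule rc_diffs(3)[OF _ rc_diffs(5)])
lift_definition less_eq_rc :: "'a rc \<Rightarrow> 'a rc \<Rightarrow> bool" is "\<lambda>x y. y - x \<in> rc_pos" .
definition less_rc :: "'a rc \<Rightarrow> 'a rc \<Rightarrow> bool" where "less_rc x y \<longleftrightarrow> x \<le> y \<and> x \<noteq> y"
definition abs_rc :: "'a rc \<Rightarrow> 'a rc" where "abs_rc x = (if x < 0 then - x else x)"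
definition sgn_rc :: "'a rc \<Rightarrow> 'a rc" where "sgn_rc x = (if x = 0 then 0 else if 0 < x then 1 else - 1)"

instance
proof
  fix x y z :: "'a rc"
  show antisym: "x \<le> y \<Longrightarrow> y \<le> x \<Longrightarrow> x = y" for x y :: "'a rc"
  proof transfer
    fix x y :: "'a alg_closure"
    assume "y - x \<in> rc_pos" "x - y \<in> rc_pos"
    then show "x = y" using field_cone_antisym[OF rc_pos_field_cone, of "y - x"] by simp
  qed
  show "x < y \<longleftrightarrow> x \<le> y \<and> \<not> y \<le> x"
    unfolding less_rc_def using antisym[of x y] by blast
  show "x \<le> y \<Longrightarrow> y \<le> z \<Longrightarrow> x \<le> z"
  proof transfer
    fix x y z :: "'a alg_closure"
    assume "y - x \<in> rc_pos" "z - y \<in> rc_pos"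
    from rc_posD(1)[OF this] show "z - x \<in> rc_pos" by simp
  qed
  show "x \<le> y \<or> y \<le> x"
  proof transfer
    fix x y :: "'a alg_closure"
    assume "x \<in> diffs rc_pos" "y \<in> diffs rc_pos"
    then have "y - x \<in> diffs rc_pos" using rc_diffs(2)[OF _ rc_diffs(4)] by simp
    from maximal_cone_total[OF rc_pos(1) this] show "y - x \<in> rc_pos \<or> x - y \<in> rc_pos" by simp
  qed
  show "x \<le> y \<Longrightarrow> z + x \<le> z + y" by transfer simp
  show "x < y \<Longrightarrow> 0 < z \<Longrightarrow> z * x < z * y"
    unfolding less_rc_def
  proof (transfer, elim conjE, intro conjI)
    fix x y z :: "'a alg_closure"
    assume "y - x \<in> rc_pos" "z - 0 \<in> rc_pos"
    then show "z * y - z * x \<in> rc_pos"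
      using rc_posD(2)[of z "y - x"] by (simp add: right_diff_distrib)
  next
    fix x y z :: "'a alg_closure"
    assume "0 \<noteq> z" "x \<noteq> y"
    then show "z * x \<noteq> z * y" by simp
  qed
  show "x + y + z = x + (y + z)" "x * y * z = x * (y * z)" "(x + y) * z = x * z + y * z"
    by (transfer, simp add: algebra_simps)+
  show "x + y = y + x" "x * y = y * x" by (transfer, simp)+
  show "0 + x = x" "1 * x = x" "- x + x = 0" "x - y = x + - y" "(0 :: 'a rc) \<noteq> 1" "inverse (0 :: 'a rc) = 0"
    by (transfer, simp)+
  show "x \<noteq> 0 \<Longrightarrow> inverse x * x = 1" "x div y = x * inverse y"
    by (transfer, simp add: divide_inverse)+
  show "x + y - x = y" "x - y - z = x - (y + z)" "0 * x = 0" "x * 0 = 0"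
    by (transfer, simp)+
  show "x \<le> x" by transfer (simp add: rc_posD(7))
  show "\<bar>x\<bar> = (if x < 0 then - x else x)" by (fact abs_rc_def)
  show "sgn x = (if x = 0 then 0 else if 0 < x then 1 else - 1)" by (fact sgn_rc_def)
qed

end

section \<open>Weighted sums of squares and the intermediate value property\<close>

inductive_set wsq :: "('a::linordered_field poly \<Rightarrow> bool) \<Rightarrow> 'a poly set" for D where
  zero: "0 \<in> wsq D"
| step: "0 \<le> s \<Longrightarrow> D f \<Longrightarrow> g \<in> wsq D \<Longrightarrow> smult s (f * f) + g \<in> wsq D"

abbreviation wsq_all :: "'a::linordered_field poly set" where
  "wsq_all \<equiv> wsq (\<lambda>_. True)"

lemma wsq_add: "g \<in> wsq D \<Longrightarrow> h \<in> wsq D \<Longrightarrow> g + h \<in> wsq D"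
  by (induction rule: wsq.induct) (auto simp: add.assoc intro: wsq.step)

lemma wsq_single: "0 \<le> s \<Longrightarrow> D f \<Longrightarrow> smult s (f * f) \<in> wsq D"
  using wsq.step[OF _ _ wsq.zero] by simp

lemma wsq_square: "f * f \<in> wsq_all"
  using wsq_single[of 1 "\<lambda>_. True" f] by simp

lemma wsq_const: "0 \<le> s \<Longrightarrow> [:s:] \<in> wsq_all"
  using wsq_single[of s "\<lambda>_. True" 1] by simp

lemma wsq_mult:
  assumes "g \<in> wsq_all" "h \<in> wsq_all"
  shows "g * h \<in> wsq_all"
  using assms(1)
proof induction
  case (step s f g)
  have "smult s (f * f) * h \<in> wsq_all"
    using assms(2)
  proof induction
    case (step t k h)
    have "smult (s * t) ((f * k) * (f * k)) \<in> wsq_all"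
      using step \<open>0 \<le> s\<close> by (intro wsq_single) auto
    moreover have "smult s (f * f) * (smult t (k * k) + h) = smult (s * t) ((f * k) * (f * k)) + smult s (f * f) * h"
      by (simp add: algebra_simps)
    ultimately show ?case using wsq_add step.IH by metis
  qed (simp add: wsq.zero)
  with step.IH show ?case unfolding distrib_right by (intro wsq_add)
qed (simp add: wsq.zero)

lemma wsq_nonneg: "g \<in> wsq D \<Longrightarrow> poly g x \<ge> 0"
  by (induction rule: wsq.induct) auto

lemma wsq_degree: "g \<in> wsq (\<lambda>f. degree f < n) \<Longrightarrow> degree g \<le> 2 * (n - 1)"
proof (induction rule: wsq.induct)
  case (step s f g)
  have "degree (smult s (f * f)) \<le> 2 * (n - 1)"
    using step(2) degree_mult_le[of f f] by (intro order_trans[OF degree_smult_le]) linarith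
  then show ?case using step.IH by (rule degree_add_le)
qed simp

text \<open>Replacing each f by f mod p changes its square by a multiple of p. The predicate D of
  \<open>wsq\<close> serves to record the degree bound obtained in this way.\<close>

lemma wsq_reduce:
  assumes "g \<in> wsq_all" "degree p > 0"
  shows "\<exists>g'\<in>wsq (\<lambda>f. degree f < degree p). p dvd g' - g"
  using assms(1)
proof induction
  case zero
  show ?case using wsq.zero by (intro bexI[of _ 0]) auto
next
  case (step s f g)
  then obtain g' where g': "g' \<in> wsq (\<lambda>f. degree f < degree p)" "p dvd g' - g" by blast
  let ?r = "f mod p"
  have "p \<noteq> 0" using assms(2) by auto
  then have "degree ?r < degree p"
    using assms(2) degree_mod_less[of p f] by (cases "?r = 0") auto
  then have "smult s (?r * ?r) + g' \<in> wsq (\<lambda>f. degree f < degree p)"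
    using step(1) g'(1) by (intro wsq.step) auto
  moreover have "p dvd ?r - f" by (metis dvd_minus_mod dvd_diff_commute)
  then have "p dvd smult s ((?r - f) * (?r + f)) + (g' - g)"
    using g'(2) by (intro dvd_add dvd_smult dvd_mult2)
  then have "p dvd (smult s (?r * ?r) + g') - (smult s (f * f) + g)"
    by (simp add: algebra_simps smult_diff_right smult_add_right)
  ultimately show ?case by blast
qed

interpretation Rep_rc: map_poly_comm_ring_hom "Rep_rc :: 'a::linordered_field rc \<Rightarrow> _"
  by unfold_locales (simp_all add: zero_rc.rep_eq one_rc.rep_eq plus_rc.rep_eq times_rc.rep_eq)

lemma Rep_rc_eq_0_iff: "Rep_rc x = 0 \<longleftrightarrow> x = 0"
  by (metis Rep_rc_inject zero_rc.rep_eq)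

lemma rc_pos_iff: "0 \<le> x \<longleftrightarrow> Rep_rc x \<in> rc_pos"
  by transfer simp

text \<open>A sign-changing polynomial \<open>p\<close> of least degree without a root between \<open>a\<close> and \<open>b\<close> is
  irreducible. Its root \<open>c\<close> in the algebraic closure generates a proper extension, to which the
  ordering extends: a relation \<open>1 + \<Sum> s\<^sub>i f\<^sub>i\<^sup>2 = p * h\<close> with \<open>degree f\<^sub>i < degree p\<close> would make \<open>h\<close>
  change sign as well, and at a root of \<open>h\<close> the left-hand side is positive. This contradicts
  the maximality of \<^const>\<open>rc_pos\<close>.\<close>

lemma rc_poly_IVT:
  fixes p :: "'a::linordered_field rc poly"
  assumes "a < b" "poly p a < 0" "0 < poly p b"
  shows "\<exists>c. a < c \<and> c < b \<and> poly p c = 0"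
  using assms(2,3)
proof (induction "degree p" arbitrary: p rule: less_induct)
  case less
  show ?case
  proof (rule ccontr)
    assume no: "\<not> ?case"
    have root: "\<exists>c. a < c \<and> c < b \<and> poly q c = 0"
      if "degree q < degree p" "sg (poly q a) \<noteq> sg (poly q b)" "poly q a \<noteq> 0" "poly q b \<noteq> 0" for q
    proof (cases "poly q a < 0")
      case True
      then have "0 < poly q b" using that by (auto simp: sg_def split: if_splits)
      with True that(1) less.hyps show ?thesis by blast
    next
      case False
      then have "poly (- q) a < 0" "0 < poly (- q) b" using that by (auto simp: sg_def split: if_splits)
      with that(1) less.hyps[of "- q"] show ?thesis by auto
    qed
    \<comment> \<open>The signs of the factors multiply to - 1 at a and to 1 at b, so one factor
      changes sign; being of smaller degree it has a root between a and b, and so would p.\<close>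
    have irred: False if p: "p = q * r" and deg: "degree q < degree p" "degree r < degree p" for q r
    proof -
      have "sg (poly q a) * sg (poly r a) = - 1" "sg (poly q b) * sg (poly r b) = 1"
        using less.prems unfolding sg_mult[symmetric] by (simp_all add: p)
      moreover have nz: "poly q a \<noteq> 0" "poly q b \<noteq> 0" "poly r a \<noteq> 0" "poly r b \<noteq> 0"
        using less.prems by (auto simp: p)
      ultimately have "sg (poly q a) \<noteq> sg (poly q b) \<or> sg (poly r a) \<noteq> sg (poly r b)" by auto
      then obtain c where "a < c" "c < b" "poly q c = 0 \<or> poly r c = 0"
        using root[OF deg(1)] root[OF deg(2)] nz by blast
      then show False using no p by auto
    qed
    have n: "degree p > 0"
    proof (rule ccontr)
      assume "\<not> ?thesis"
      then obtain k where "p = [:k:]" by (auto elim: degree_eq_zeroE)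
      with less.prems show False by simp
    qed
    have p0: "p \<noteq> 0" using n by auto
    have "degree (map_poly Rep_rc p) = degree p"
      by (rule map_poly_degree_eq) (use p0 in \<open>simp add: Rep_rc_eq_0_iff\<close>)
    with n obtain c where c: "poly (map_poly Rep_rc p) c = 0"
      using alg_closed_imp_poly_has_root by metis
    define ev where "ev f = poly (map_poly Rep_rc f) c" for f
    have ev: "ev (f + g) = ev f + ev g" "ev (f - g) = ev f - ev g" "ev (f * g) = ev f * ev g"
      "ev 0 = 0" "ev 1 = 1" "ev [:s:] = Rep_rc s" "ev (- f) = - ev f" for f g s
      by (simp_all add: ev_def hom_distribs)
    have evp: "ev p = 0" using c by (simp add: ev_def)

    \<comment> \<open>A nonzero polynomial of least degree vanishing at c divides p, so
      \<open>irred\<close> forbids a degree below that of p.\<close>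
    have minimal: "ev m \<noteq> 0" if "m \<noteq> 0" "degree m < degree p" for m
    proof
      assume "ev m = 0"
      with that(1) obtain m' where m': "m' \<noteq> 0" "ev m' = 0" "\<And>m''. m'' \<noteq> 0 \<Longrightarrow> ev m'' = 0 \<Longrightarrow> degree m' \<le> degree m''"
        using ex_has_least_nat[of "\<lambda>m. m \<noteq> 0 \<and> ev m = 0" m degree] by blast
      have dm: "degree m' < degree p" using m'(3)[OF that(1) \<open>ev m = 0\<close>] that(2) by linarith
      have pm: "p = (p div m') * m' + p mod m'" by simp
      have "ev p = ev (p div m') * ev m' + ev (p mod m')"
        by (subst pm) (simp only: ev)
      then have "ev (p mod m') = 0" using evp m'(2) by simp
      then have "p mod m' = 0"
        using m'(1,3) degree_mod_less[of m' p] by (metis not_le)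
      then have p: "p = (p div m') * m'" using pm by simp
      have "degree m' > 0"
      proof (rule ccontr)
        assume "\<not> ?thesis"
        then obtain k where "m' = [:k:]" by (auto elim: degree_eq_zeroE)
        with m' show False by (simp add: ev Rep_rc_eq_0_iff)
      qed
      moreover have "degree p = degree (p div m') + degree m'"
        using p p0 by (metis degree_mult_eq mult_eq_0_iff)
      ultimately have "degree (p div m') < degree p" by simp
      with irred[OF p] dm show False by blast
    qed

    have ev_mod: "ev (q mod p) = ev q" for q
    proof -
      have "ev q = ev ((q div p) * p + q mod p)" by simp
      also have "\<dots> = ev (q mod p)" unfolding ev evp by simp
      finally show ?thesis ..
    qed
    have mod_deg: "degree (q mod p) < degree p" for q
      using n degree_mod_less[OF p0, of q] by (cases "q mod p = 0") auto

    have dvd_if_ev: "p dvd q" if "ev q = 0" for q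
      using minimal[of "q mod p"] that mod_deg ev_mod by (metis dvd_eq_mod_eq_0)

    \<comment> \<open>As p vanishes at c, the remainder r of p modulo q takes the value of - (p div
      q) * q there, so an inverse for r, which has smaller degree, yields one for q.\<close>
    have inv: "\<exists>u. ev u * ev q = 1" if "q \<noteq> 0" "degree q < degree p" for q
      using that
    proof (induction "degree q" arbitrary: q rule: less_induct)
      case (less q)
      show ?case
      proof (cases "degree q = 0")
        case True
        then obtain k where k: "q = [:k:]" by (auto elim: degree_eq_zeroE)
        then have "[:inverse k:] * q = 1" using less.prems by (simp add: one_pCons)
        then show ?thesis by (metis ev(3,5))
      next
        case False
        define r where "r = p mod q"
        have p: "p = (p div q) * q + r" by (simp add: r_def)
        have "r \<noteq> 0"
        proof
          assume "r = 0"
          then have p': "p = (p div q) * q" using p by simp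
          then have "degree p = degree (p div q) + degree q"
            using p0 by (metis degree_mult_eq mult_eq_0_iff)
          then show False using irred[OF p'] False less.prems by simp
        qed
        then have dr: "degree r < degree q" using degree_mod_less[OF less.prems(1), of p] by (simp add: r_def)
        obtain u where u: "ev u * ev r = 1" using less.hyps[OF dr \<open>r \<noteq> 0\<close>] dr less.prems by auto
        have "ev p = ev (p div q) * ev q + ev r" by (subst p) (simp only: ev)
        then have "ev r = - (ev (p div q) * ev q)" using evp by (simp add: eq_neg_iff_add_eq_0 add.commute)
        then have "ev (- (u * (p div q))) * ev q = 1" using u by (simp add: ev mult.assoc)
        then show ?thesis by blast
      qed
    qed
    have inv_range: "\<exists>u. inverse (ev q) = ev u" for q
    proof (cases "ev q = 0")
      case True
      then show ?thesis using ev(4) by (intro exI[of _ 0]) simp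
    next
      case False
      have "q mod p \<noteq> 0"
      proof
        assume "q mod p = 0"
        then show False using False ev_mod[of q] ev(4) by simp
      qed
      from inv[OF this mod_deg] obtain u where "ev u * ev q = 1" unfolding ev_mod by blast
      then have "inverse (ev q) = ev u" using inverse_unique[of "ev q" "ev u"] by (simp add: mult.commute)
      then show ?thesis by blast
    qed

    \<comment> \<open>The sums of s * y * y with s \<ge> 0 in the real closure and y a value of
      \<open>ev\<close>. By \<open>inv_range\<close> these values form a field, and W is a cone in
      it extending \<open>rc_pos\<close>.\<close>
    define W where "W = ev ` wsq_all"
    have W: "z \<in> W" if "g \<in> wsq_all" "z = ev g" for z g using that by (auto simp: W_def)
    have "field_cone W"
      unfolding field_cone_def
    proof (intro conjI ballI)
      fix x y assume "x \<in> W" "y \<in> W"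
      then obtain g h where gh: "x = ev g" "y = ev h" "g \<in> wsq_all" "h \<in> wsq_all" by (auto simp: W_def)
      show "x + y \<in> W" by (rule W[OF wsq_add[OF gh(3,4)]]) (simp add: gh ev)
      show "x * y \<in> W" by (rule W[OF wsq_mult[OF gh(3,4)]]) (simp add: gh ev)
      show "(x - y) * (x - y) \<in> W" by (rule W[OF wsq_square[of "g - h"]]) (simp add: gh ev)
    next
      fix x assume "x \<in> W"
      then obtain g where g: "x = ev g" "g \<in> wsq_all" by (auto simp: W_def)
      obtain u where u: "inverse x = ev u" using inv_range g by blast
      have "inverse x = x * (inverse x * inverse x)" by (cases "x = 0") auto
      then have "inverse x = ev (g * (u * u))" unfolding u by (simp add: ev g)
      then show "inverse x \<in> W" by (rule W[OF wsq_mult[OF g(2) wsq_square]])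
    next
      show "1 \<in> W" by (rule W[OF wsq_square[of 1]]) (simp add: ev)
      show "- 1 \<notin> W"
      proof
        assume "- 1 \<in> W"
        then obtain g where g: "- 1 = ev g" "g \<in> wsq_all" by (auto simp: W_def)
        obtain g' where g': "g' \<in> wsq (\<lambda>f. degree f < degree p)" "p dvd g' - g"
          using wsq_reduce[OF g(2) n] by blast
        then obtain k where "g' - g = p * k" by (auto elim: dvdE)
        then have "ev (g' - g) = 0" by (simp add: ev evp)
        then have "ev (1 + g') = 0" using g(1)[symmetric] by (simp add: ev add.commute)
        from dvd_if_ev[OF this] obtain h where h: "1 + g' = p * h" by (auto elim: dvdE)
        have pos: "poly (1 + g') x > 0" for x
          using wsq_nonneg[OF g'(1), of x] by (simp add: add_pos_nonneg)
        then have "h \<noteq> 0" using h by auto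
        \<comment> \<open>The right-hand side is at most 2 (deg p - 1), which leaves for h a degree
          below that of p and brings it under the induction hypothesis.\<close>
        then have "degree p + degree h = degree (1 + g')" using p0 h by (simp add: degree_mult_eq)
        also have "\<dots> \<le> 2 * (degree p - 1)"
          using wsq_degree[OF g'(1)] by (intro degree_add_le) auto
        finally have "degree h < degree p" using n by linarith
        moreover have "poly p a * poly h a > 0" "poly p b * poly h b > 0"
          using pos[of a] pos[of b] unfolding h by simp_all
        then have "poly h a < 0" "0 < poly h b"
          using less.prems by (auto simp: zero_less_mult_iff)
        ultimately obtain d where "poly h d = 0" using less.hyps by blast
        then show False using pos[of d] unfolding h by simp
      qed
    qed
    moreover have "rc_pos \<subseteq> W"
    proof
      fix x :: "'a alg_closure" assume x: "x \<in> rc_pos"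
      then have xs: "Rep_rc (Abs_rc x) = x" by (intro Abs_rc_inverse rc_diffs(1))
      then have "0 \<le> Abs_rc x" using x by (simp add: rc_pos_iff)
      from wsq_const[OF this] show "x \<in> W" by (rule W) (simp add: ev xs)
    qed
    ultimately have WP: "W = rc_pos" by (rule maximal_coneD(2)[OF rc_pos(1)])
    \<comment> \<open>Since 4 c = (c + 1)^2 - (c - 1)^2 and both squares lie in W, which equals
      \<open>rc_pos\<close>, the root c belongs to the real closure itself.\<close>
    let ?X = "[:0, 1:] :: 'a rc poly"
    have "ev 2 = 2" by (metis ev(1,5) one_add_one)
    then have "ev x * 4 = ev ((x + 1) * (x + 1)) - ev ((x - 1) * (x - 1))" for x
      by (simp add: ev algebra_simps)
    from this[of ?X] have "ev ?X * 4 = ev ((?X + 1) * (?X + 1)) - ev ((?X - 1) * (?X - 1))" .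
    moreover have "ev ((?X + 1) * (?X + 1)) \<in> rc_pos" "ev ((?X - 1) * (?X - 1)) \<in> rc_pos"
      using W[OF wsq_square] unfolding WP by blast+
    ultimately have "ev ?X * 4 \<in> diffs rc_pos" by (rule_tac diffsI)
    moreover have "(4 :: 'a alg_closure) = Rep_rc 4" by (metis Rep_rc.base.hom_numeral)
    then have "(4 :: 'a alg_closure) \<in> diffs rc_pos" using Rep_rc[of 4] by (simp only:)
    then have "inverse (4 :: 'a alg_closure) \<in> diffs rc_pos" by (rule rc_diffs(5))
    ultimately have "ev ?X * 4 * inverse 4 \<in> diffs rc_pos" by (rule rc_diffs(3))
    then have "c \<in> diffs rc_pos" by (simp add: ev_def hom_distribs)
    then have Rc: "Rep_rc (Abs_rc c) = c" by (rule Abs_rc_inverse)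
    have "Rep_rc (poly p (Abs_rc c)) = 0"
      using c Rep_rc.base.poly_map_poly[of p "Abs_rc c"] by (simp add: Rc)
    then have pc: "poly p (Abs_rc c) = 0" by (simp add: Rep_rc_eq_0_iff)
    \<comment> \<open>The root c lies outside the interval, so the linear factor has the same sign
      at a and b and r inherits the sign change in smaller degree. This covers linear p as
      well.\<close>
    then obtain r where r: "p = [:- Abs_rc c, 1:] * r" by (auto simp: poly_eq_0_iff_dvd elim: dvdE)
    have "r \<noteq> 0" using p0 r by auto
    then have "degree r < degree p" unfolding r by (subst degree_mult_eq) auto
    moreover have out: "Abs_rc c \<le> a \<or> b \<le> Abs_rc c" using no pc by force
    have nz: "poly r a \<noteq> 0" "poly r b \<noteq> 0" "a \<noteq> Abs_rc c" "b \<noteq> Abs_rc c"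
      using less.prems by (auto simp: r)
    have "sg (poly r a) \<noteq> sg (poly r b)"
    proof -
      have "sg (a - Abs_rc c) = sg (b - Abs_rc c)" "a - Abs_rc c \<noteq> 0"
        using out nz \<open>a < b\<close> by (auto simp: sg_def)
      moreover have "sg ((a - Abs_rc c) * poly r a) = - 1" "sg ((b - Abs_rc c) * poly r b) = 1"
        using less.prems by (simp_all add: r algebra_simps)
      ultimately show ?thesis unfolding sg_mult by auto
    qed
    ultimately obtain d where "a < d" "d < b" "poly r d = 0" using root nz by blast
    then show False using no r by auto
  qed
qed

instance rc :: (linordered_field) rcf
  by (rule rcf_class_if_poly_IVT) (rule rc_poly_IVT)

definition to_rc :: "'a::linordered_field \<Rightarrow> 'a rc" where
  "to_rc x = Abs_rc (to_ac x)"

lemma Rep_to_rc: "Rep_rc (to_rc x) = to_ac x"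
proof -
  have "to_ac x = to_ac (max x 0) - to_ac (max (- x) 0)"
    unfolding to_ac_diff[symmetric] by (auto simp: max_def)
  moreover have "to_ac (max x 0) \<in> rc_pos" "to_ac (max (- x) 0) \<in> rc_pos"
    using rc_pos(2) by auto
  ultimately have "to_ac x \<in> diffs rc_pos" by (rule_tac diffsI)
  then show ?thesis unfolding to_rc_def by (rule Abs_rc_inverse)
qed

lemma to_rc_hom: "comm_ring_hom (to_rc :: 'a::linordered_field \<Rightarrow> 'a rc)"
  by unfold_locales
    (simp_all add: Rep_rc_inject[symmetric] Rep_to_rc zero_rc.rep_eq one_rc.rep_eq plus_rc.rep_eq times_rc.rep_eq)

lemma to_rc_nonneg: "0 \<le> x \<Longrightarrow> 0 \<le> to_rc x"
  unfolding rc_pos_iff Rep_to_rc using rc_pos(2) by auto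

lemma to_rc_inject: "to_rc x = to_rc y \<longleftrightarrow> x = y"
  by (metis Rep_to_rc to_ac_eq_iff)

section \<open>The residue field of a prime cone\<close>

definition real_cone :: "'d::finite rpoly set \<Rightarrow> bool" where
  "real_cone P \<longleftrightarrow> (\<forall>F. finite F \<longrightarrow> (\<exists>x. \<forall>f\<in>F. 0 \<le> peval x f \<longleftrightarrow> f \<in> P))"

text \<open>A type cannot depend on a prime cone. The residue domain is therefore only formed for one cone
  fixed by choice, a counterexample to \<^const>\<open>real_cone\<close> if there is one.\<close>

definition exc_cone :: "'d::finite rpoly set" where
  "exc_cone = (if \<exists>P :: 'd rpoly set. prime_cone P \<and> \<not> real_cone P
     then SOME P. prime_cone P \<and> \<not> real_cone P else {f. 0 \<le> peval (\<lambda>_. 0) f})"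

text \<open>Makes the default value of \<open>exc_cone\<close> a prime cone, so that the residue
  domain is an ordered domain in every case.\<close>

lemma prime_cone_point: "prime_cone {f. 0 \<le> peval x f}"
proof -
  interpret comm_ring_hom "peval x" by (rule peval_hom)
  show ?thesis
    by (auto simp: prime_cone_def preordering_def support_def hom_add hom_mult hom_uminus hom_power)
qed

lemma prime_exc_cone: "prime_cone exc_cone"
  using someI_ex[of "\<lambda>P. prime_cone P \<and> \<not> real_cone P"] prime_cone_point
  by (auto simp: exc_cone_def)

text \<open>\<open>exc_cone\<close> is a counterexample as soon as there is one, so settling this
  single cone settles all.\<close>

lemma real_cone_if_exc_cone:
  assumes "real_cone (exc_cone :: 'd::finite rpoly set)" "prime_cone (P :: 'd rpoly set)"
  shows "real_cone P"
proof (rule ccontr)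
  assume "\<not> real_cone P"
  with assms(2) have ex: "\<exists>P :: 'd rpoly set. prime_cone P \<and> \<not> real_cone P" by blast
  from someI_ex[OF this] have "\<not> real_cone (exc_cone :: 'd rpoly set)"
    using ex unfolding exc_cone_def by simp
  with assms(1) show False by simp
qed

lemma exc_pre: "preordering exc_cone" and exc_total: "a \<in> exc_cone \<or> - a \<in> exc_cone"
  and exc_m1: "- 1 \<notin> exc_cone"
  and exc_prime: "a * b \<in> support exc_cone \<Longrightarrow> a \<in> support exc_cone \<or> b \<in> support exc_cone"
  using prime_exc_cone unfolding prime_cone_def by blast+

lemma exc_add: "a \<in> exc_cone \<Longrightarrow> b \<in> exc_cone \<Longrightarrow> a + b \<in> exc_cone"
  and exc_mult: "a \<in> exc_cone \<Longrightarrow> b \<in> exc_cone \<Longrightarrow> a * b \<in> exc_cone"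
  and exc_0: "0 \<in> exc_cone"
  by (rule preordering_add[OF exc_pre] preordering_mult[OF exc_pre] preordering_0[OF exc_pre]; assumption)+

definition excs :: "'d::finite rpoly set" where "excs = support exc_cone"

lemma excs_iff: "a \<in> excs \<longleftrightarrow> a \<in> exc_cone \<and> - a \<in> exc_cone"
  by (simp add: excs_def support_def)

lemma excs_0: "0 \<in> excs" by (simp add: excs_iff exc_0)

lemma excs_add: "a \<in> excs \<Longrightarrow> b \<in> excs \<Longrightarrow> a + b \<in> excs"
  unfolding excs_iff using exc_add[of a b] exc_add[of "- a" "- b"] by simp

lemma excs_uminus: "a \<in> excs \<Longrightarrow> - a \<in> excs"
  by (simp add: excs_iff)

lemma excs_mult: "a \<in> excs \<Longrightarrow> b * a \<in> excs"
  unfolding excs_def by (rule support_mult[OF exc_pre exc_total])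

lemma exc_cong:
  assumes "a - b \<in> excs"
  shows "a \<in> exc_cone \<longleftrightarrow> b \<in> exc_cone"
  using exc_add[of "a - b" b] exc_add[of "b - a" a] assms by (auto simp: excs_iff)

\<comment> \<open>The ordered residue domain and its real closure\<close>
quotient_type (overloaded) 'd kdom = "'d::finite rpoly" / "\<lambda>p q. p - q \<in> excs"
  morphisms kdom_rep to_kdom
proof (rule equivpI)
  show "reflp (\<lambda>p q :: 'd rpoly. p - q \<in> excs)" by (simp add: reflp_def excs_0)
  show "symp (\<lambda>p q :: 'd rpoly. p - q \<in> excs)"
    unfolding symp_def using excs_uminus by (metis minus_diff_eq)
  show "transp (\<lambda>p q :: 'd rpoly. p - q \<in> excs)"
    unfolding transp_def
  proof (intro allI impI)
    fix p q r :: "'d rpoly" assume "p - q \<in> excs" "q - r \<in> excs"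
    from excs_add[OF this] show "p - r \<in> excs" by simp
  qed
qed

instantiation kdom :: (finite) linordered_idom
begin

lift_definition zero_kdom :: "'a kdom" is 0 .
lift_definition one_kdom :: "'a kdom" is 1 .
lift_definition plus_kdom :: "'a kdom \<Rightarrow> 'a kdom \<Rightarrow> 'a kdom" is "(+)"
proof -
  fix a b c d :: "'a rpoly" assume "a - b \<in> excs" "c - d \<in> excs"
  from excs_add[OF this] show "(a + c) - (b + d) \<in> excs" by (simp add: algebra_simps)
qed
lift_definition uminus_kdom :: "'a kdom \<Rightarrow> 'a kdom" is uminus
proof -
  fix a b :: "'a rpoly" assume "a - b \<in> excs"
  from excs_uminus[OF this] show "- a - - b \<in> excs" by simp
qed
lift_definition minus_kdom :: "'a kdom \<Rightarrow> 'a kdom \<Rightarrow> 'a kdom" is "(-)"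
proof -
  fix a b c d :: "'a rpoly" assume "a - b \<in> excs" "c - d \<in> excs"
  from excs_add[OF this(1) excs_uminus[OF this(2)]] show "(a - c) - (b - d) \<in> excs" by (simp add: algebra_simps)
qed
lift_definition times_kdom :: "'a kdom \<Rightarrow> 'a kdom \<Rightarrow> 'a kdom" is "(*)"
proof -
  fix a b c d :: "'a rpoly" assume "a - b \<in> excs" "c - d \<in> excs"
  from excs_add[OF excs_mult[OF this(1), of c] excs_mult[OF this(2), of b]]
  show "a * c - b * d \<in> excs" by (simp add: algebra_simps)
qed
lift_definition less_eq_kdom :: "'a kdom \<Rightarrow> 'a kdom \<Rightarrow> bool" is "\<lambda>x y. y - x \<in> exc_cone"
proof -
  fix a b c d :: "'a rpoly" assume "a - b \<in> excs" "c - d \<in> excs"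
  from excs_add[OF this(2) excs_uminus[OF this(1)]] have "(c - a) - (d - b) \<in> excs" by (simp add: algebra_simps)
  from exc_cong[OF this] show "c - a \<in> exc_cone \<longleftrightarrow> d - b \<in> exc_cone" .
qed
definition less_kdom :: "'a kdom \<Rightarrow> 'a kdom \<Rightarrow> bool" where "less_kdom x y \<longleftrightarrow> x \<le> y \<and> x \<noteq> y"
definition abs_kdom :: "'a kdom \<Rightarrow> 'a kdom" where "abs_kdom x = (if x < 0 then - x else x)"
definition sgn_kdom :: "'a kdom \<Rightarrow> 'a kdom" where "sgn_kdom x = (if x = 0 then 0 else if 0 < x then 1 else - 1)"

instance
proof
  fix x y z :: "'a kdom"
  show antisym: "x \<le> y \<Longrightarrow> y \<le> x \<Longrightarrow> x = y" for x y :: "'a kdom"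
    by transfer (simp add: excs_iff)
  show "x < y \<longleftrightarrow> x \<le> y \<and> \<not> y \<le> x"
  proof -
    have "x \<le> x" by transfer (simp add: exc_0)
    then show ?thesis unfolding less_kdom_def using antisym[of x y] by blast
  qed
  show "x \<le> x" by transfer (simp add: exc_0)
  show "x \<le> y \<Longrightarrow> y \<le> z \<Longrightarrow> x \<le> z"
  proof transfer
    fix x y z :: "'a rpoly"
    assume "y - x \<in> exc_cone" "z - y \<in> exc_cone"
    from exc_add[OF this] show "z - x \<in> exc_cone" by simp
  qed
  show "x \<le> y \<or> y \<le> x"
  proof transfer
    fix x y :: "'a rpoly"
    show "y - x \<in> exc_cone \<or> x - y \<in> exc_cone" using exc_total[of "y - x"] by simp
  qed
  show "x \<le> y \<Longrightarrow> z + x \<le> z + y" by transfer simp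
  show "x + y + z = x + (y + z)" "x * y * z = x * (y * z)" "(x + y) * z = x * z + y * z"
    "x + y = y + x" "x * y = y * x" "0 + x = x" "1 * x = x" "- x + x = 0" "x - y = x + - y"
    "x + y - x = y" "x - y - z = x - (y + z)" "0 * x = 0" "x * 0 = 0"
    by (transfer, simp add: algebra_simps excs_0)+
  show "(0 :: 'a kdom) \<noteq> 1"
    by transfer (use exc_m1 in \<open>auto simp: excs_iff\<close>)
  show "x < y \<Longrightarrow> 0 < z \<Longrightarrow> z * x < z * y"
    unfolding less_kdom_def
  proof (elim conjE, intro conjI)
    assume "x \<le> y" "0 \<le> z"
    then show "z * x \<le> z * y"
    proof transfer
      fix x y z :: "'a rpoly"
      assume "y - x \<in> exc_cone" "z - 0 \<in> exc_cone"
      with exc_mult[of z "y - x"] show "z * y - z * x \<in> exc_cone" by (simp add: right_diff_distrib)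
    qed
  next
    \<comment> \<open>Strictness of the product inequality is where primality of the support
      enters.\<close>
    assume "0 \<noteq> z" "x \<noteq> y"
    then show "z * x \<noteq> z * y"
    proof (transfer, intro notI)
      fix x y z :: "'a rpoly"
      assume *: "0 - z \<notin> excs" "x - y \<notin> excs" and "z * x - z * y \<in> excs"
      then have "z * (x - y) \<in> excs" by (simp add: right_diff_distrib)
      then have "z \<in> excs \<or> x - y \<in> excs" unfolding excs_def by (rule exc_prime)
      with * excs_uminus[of z] show False by auto
    qed
  qed
  show "\<bar>x\<bar> = (if x < 0 then - x else x)" by (fact abs_kdom_def)
  show "sgn x = (if x = 0 then 0 else if 0 < x then 1 else - 1)" by (fact sgn_kdom_def)
qed

end

lemma to_kdom_hom: "comm_ring_hom to_kdom"
  by unfold_locales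
    (simp_all add: zero_kdom.abs_eq one_kdom.abs_eq plus_kdom.abs_eq times_kdom.abs_eq)

lemma to_kdom_nonneg: "0 \<le> to_kdom p \<longleftrightarrow> p \<in> exc_cone"
  by (simp add: zero_kdom.abs_eq less_eq_kdom.abs_eq)

definition residue_hom :: "'d::finite rpoly \<Rightarrow> 'd kdom fract rc" where
  "residue_hom p = to_rc (Fract (to_kdom p) 1)"

lemma residue_hom: "comm_ring_hom (residue_hom :: 'd::finite rpoly \<Rightarrow> _)"
proof -
  interpret a: comm_ring_hom to_kdom by (rule to_kdom_hom)
  interpret b: comm_ring_hom to_rc by (rule to_rc_hom)
  have "Fract 0 1 = (0 :: 'd kdom fract)" "Fract 1 1 = (1 :: 'd kdom fract)"
    by (simp_all add: Zero_fract_def One_fract_def)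
  then show ?thesis
    by unfold_locales
      (simp_all add: residue_hom_def a.hom_add a.hom_mult b.hom_add[symmetric] b.hom_mult[symmetric])
qed

text \<open>If p is outside the cone, then - p is inside and p has a value at most 0; the value 0
  would put p into the support, since the maps from the residue domain onwards are
  injective.\<close>

lemma residue_hom_nonneg: "0 \<le> residue_hom p \<longleftrightarrow> p \<in> exc_cone"
proof -
  interpret comm_ring_hom residue_hom by (rule residue_hom)
  have pos: "0 \<le> residue_hom p" if "p \<in> exc_cone" for p
    unfolding residue_hom_def using that
    by (intro to_rc_nonneg) (simp add: zero_le_Fract_iff to_kdom_nonneg)
  have inj: "to_kdom p = 0" if "residue_hom p = 0"
  proof -
    have "residue_hom p = to_rc 0" using that comm_ring_hom.axioms to_rc_hom
      by (metis Rep_rc_eq_0_iff Rep_to_rc to_ac_0)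
    then show ?thesis
      by (simp add: residue_hom_def to_rc_inject Zero_fract_def eq_fract)
  qed
  show ?thesis
  proof
    assume "0 \<le> residue_hom p"
    show "p \<in> exc_cone"
    proof (rule ccontr)
      assume p: "p \<notin> exc_cone"
      then have "0 \<le> residue_hom (- p)" using exc_total by (intro pos) blast
      with \<open>0 \<le> residue_hom p\<close> have "residue_hom p = 0" by (simp add: hom_uminus)
      from inj[OF this] have "0 \<le> to_kdom p" by simp
      with p show False by (simp add: to_kdom_nonneg)
    qed
  qed (rule pos)
qed

theorem prime_cone_real:
  assumes "prime_cone (P :: 'd::finite rpoly set)"
  shows "real_cone P"
proof (rule real_cone_if_exc_cone)
  show "real_cone (exc_cone :: 'd rpoly set)"
    unfolding real_cone_def
  proof (intro allI impI)
    fix F :: "'d rpoly set" assume "finite F"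
    from real_point_of_sign_condition[OF residue_hom this]
    obtain x where x: "\<And>f. f \<in> F \<Longrightarrow> sg (peval x f) = sg (residue_hom f)" by blast
    have "0 \<le> peval x f \<longleftrightarrow> f \<in> exc_cone" if "f \<in> F" for f
      using x[OF that] unfolding residue_hom_nonneg[symmetric] by (auto simp: sg_def split: if_splits)
    then show "\<exists>x. \<forall>f\<in>F. 0 \<le> peval x f \<longleftrightarrow> f \<in> exc_cone" by blast
  qed
qed fact

section \<open>The Positivstellensatz\<close>

lemma preordering_gen: "preordering (preordering_gen G)" and preordering_gen_superset: "G \<subseteq> preordering_gen G"
  unfolding preordering_gen_def preordering_def by blast+

lemma preordering_gen_least: "preordering T \<Longrightarrow> G \<subseteq> T \<Longrightarrow> preordering_gen G \<subseteq> T"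
  unfolding preordering_gen_def by blast

lemma preordering_gen_nonneg:
  assumes "t \<in> preordering_gen G" "x \<in> K_set G"
  shows "0 \<le> peval x t"
proof -
  have "preordering {f. 0 \<le> peval x f}" using prime_cone_point[of x] unfolding prime_cone_def by blast
  then have "preordering_gen G \<subseteq> {f. 0 \<le> peval x f}"
    by (rule preordering_gen_least) (use assms(2) in \<open>auto simp: K_set_def\<close>)
  with assms(1) show ?thesis by blast
qed

text \<open>T is any preordering above G, so that it can be taken to be
  \<open>adjoin (preordering_gen G) (- f)\<close>, whose elements display the s and t of a
  certificate.\<close>

theorem Positivstellensatz:
  fixes G :: "'d::finite rpoly set"
  assumes "finite G" and T: "preordering T" "G \<subseteq> T" and "\<And>x. x \<in> K_set G \<Longrightarrow> peval x f = 0"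
  shows "\<exists>m. - (f ^ (2 * m)) \<in> T"
proof (rule ccontr)
  assume "\<not> ?thesis"
  then obtain P where P: "prime_cone P" "T \<subseteq> P" "f \<notin> support P"
    using prime_cone_exists[OF T(1), of f] by blast
  \<comment> \<open>Membership of f in the support is a condition on both f and - f, so both signs
    are prescribed.\<close>
  have fin: "finite (insert f (insert (- f) G))" using assms(1) by simp
  obtain x where x: "\<forall>g\<in>insert f (insert (- f) G). 0 \<le> peval x g \<longleftrightarrow> g \<in> P"
    using prime_cone_real[OF P(1)] fin unfolding real_cone_def by blast
  have "x \<in> K_set G" using x T(2) P(2) unfolding K_set_def by blast
  from assms(4)[OF this] have "peval x f = 0" .
  moreover have "peval x (- f) = - peval x f"
  proof -
    interpret comm_ring_hom "peval x" by (rule peval_hom)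
    show ?thesis by (rule hom_uminus)
  qed
  ultimately have "f \<in> support P" using x by (simp add: support_def)
  with P(3) show False by simp
qed

lemma peval_simps:
  "peval x 1 = 1" "peval x (p + q) = peval x p + peval x q" "peval x (p * q) = peval x p * peval x q"
  "peval x (- p) = - peval x p" "peval x (p ^ k) = peval x p ^ k"
proof -
  interpret comm_ring_hom "peval x" by (rule peval_hom)
  show "peval x 1 = 1" "peval x (p + q) = peval x p + peval x q" "peval x (p * q) = peval x p * peval x q"
    "peval x (- p) = - peval x p" "peval x (p ^ k) = peval x p ^ k"
    by (simp_all add: hom_add hom_mult hom_uminus hom_power)
qed

context
  fixes G :: "'d::finite rpoly set"
  assumes fin: "finite G"
begin

text \<open>The common source of two certificates: g = 1 for positive f, where the set of points
  with f \<le> 0 is empty, and g = f for nonnegative f.\<close>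

lemma Positivstellensatz_adjoin:
  assumes "\<And>x. x \<in> K_set G \<Longrightarrow> peval x f \<le> 0 \<Longrightarrow> peval x g = 0"
  shows "\<exists>m. \<exists>s\<in>preordering_gen G. \<exists>t\<in>preordering_gen G. s * f = g ^ (2 * m) + t"
proof -
  let ?T = "adjoin (preordering_gen G) (- f)"
  have "\<exists>m. - (g ^ (2 * m)) \<in> ?T"
  proof (rule Positivstellensatz)
    show "finite (insert (- f) G)" using fin by simp
    show "preordering ?T" by (rule adjoin_preordering[OF preordering_gen])
    show "insert (- f) G \<subseteq> ?T"
      using adjoin_superset[OF preordering_gen[of G], of "- f"] preordering_gen_superset[of G] by blast
    show "peval x g = 0" if "x \<in> K_set (insert (- f) G)" for x
      using assms[of x] that by (simp add: K_set_def peval_simps)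
  qed
  then obtain m t s where *: "- (g ^ (2 * m)) = t + - f * s" "t \<in> preordering_gen G" "s \<in> preordering_gen G"
    unfolding adjoin_def by blast
  have "s * f = t - (t + - f * s)" by (simp add: mult.commute)
  also have "\<dots> = g ^ (2 * m) + t" unfolding *(1)[symmetric] by simp
  finally have "s * f = g ^ (2 * m) + t" .
  with *(2,3) show ?thesis by blast
qed

lemma pos_on_K_set_iff:
  "(\<forall>x\<in>K_set G. 0 < peval x f) \<longleftrightarrow> (\<exists>s\<in>preordering_gen G. \<exists>t\<in>preordering_gen G. s * f = 1 + t)"
proof
  assume "\<forall>x\<in>K_set G. 0 < peval x f"
  then have "peval x 1 = 0" if "x \<in> K_set G" "peval x f \<le> 0" for x using that by force
  from Positivstellensatz_adjoin[OF this]
  show "\<exists>s\<in>preordering_gen G. \<exists>t\<in>preordering_gen G. s * f = 1 + t" by simp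
next
  assume "\<exists>s\<in>preordering_gen G. \<exists>t\<in>preordering_gen G. s * f = 1 + t"
  then obtain s t where st: "s \<in> preordering_gen G" "t \<in> preordering_gen G" "s * f = 1 + t" by blast
  show "\<forall>x\<in>K_set G. 0 < peval x f"
  proof
    fix x assume x: "x \<in> K_set G"
    have "peval x s * peval x f = 1 + peval x t"
      using arg_cong[OF st(3), of "peval x"] by (simp add: peval_simps)
    moreover have "0 \<le> peval x s" "0 \<le> peval x t" using st x by (auto intro: preordering_gen_nonneg)
    ultimately have "0 < peval x s * peval x f" by simp
    with \<open>0 \<le> peval x s\<close> show "0 < peval x f" by (simp add: zero_less_mult_iff)
  qed
qed

lemma nonneg_on_K_set_iff:
  "(\<forall>x\<in>K_set G. 0 \<le> peval x f) \<longleftrightarrow>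
    (\<exists>m. \<exists>s\<in>preordering_gen G. \<exists>t\<in>preordering_gen G. s * f = f ^ (2 * m) + t)"
proof
  assume f: "\<forall>x\<in>K_set G. 0 \<le> peval x f"
  show "\<exists>m. \<exists>s\<in>preordering_gen G. \<exists>t\<in>preordering_gen G. s * f = f ^ (2 * m) + t"
  proof (rule Positivstellensatz_adjoin)
    show "peval x f = 0" if "x \<in> K_set G" "peval x f \<le> 0" for x
      using f that by (simp add: order_antisym)
  qed
next
  assume "\<exists>m. \<exists>s\<in>preordering_gen G. \<exists>t\<in>preordering_gen G. s * f = f ^ (2 * m) + t"
  then obtain m s t where st: "s \<in> preordering_gen G" "t \<in> preordering_gen G" "s * f = f ^ (2 * m) + t" by blast
  show "\<forall>x\<in>K_set G. 0 \<le> peval x f"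
  proof
    fix x assume x: "x \<in> K_set G"
    have eq: "peval x s * peval x f = peval x f ^ (2 * m) + peval x t"
      using arg_cong[OF st(3), of "peval x"] by (simp add: peval_simps)
    have nn: "0 \<le> peval x s" "0 \<le> peval x t" using st x by (auto intro: preordering_gen_nonneg)
    show "0 \<le> peval x f"
    proof (rule ccontr)
      assume f: "\<not> 0 \<le> peval x f"
      then have "0 < peval x f ^ (2 * m)" by (simp add: power_mult)
      moreover have "peval x s * peval x f \<le> 0" using nn f by (simp add: mult_nonneg_nonpos)
      ultimately show False using eq nn by linarith
    qed
  qed
qed

lemma zero_on_K_set_iff:
  "(\<forall>x\<in>K_set G. peval x f = 0) \<longleftrightarrow> (\<exists>m. - (f ^ (2 * m)) \<in> preordering_gen G)"
proof
  assume "\<forall>x\<in>K_set G. peval x f = 0"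
  then show "\<exists>m. - (f ^ (2 * m)) \<in> preordering_gen G"
    using Positivstellensatz[OF fin preordering_gen preordering_gen_superset] by blast
next
  assume "\<exists>m. - (f ^ (2 * m)) \<in> preordering_gen G"
  then obtain m where m: "- (f ^ (2 * m)) \<in> preordering_gen G" by blast
  show "\<forall>x\<in>K_set G. peval x f = 0"
  proof
    fix x assume "x \<in> K_set G"
    from preordering_gen_nonneg[OF m this] have "\<not> 0 < peval x f ^ (2 * m)" by (simp add: peval_simps)
    then show "peval x f = 0" by (rule contrapos_np) (simp add: power_mult)
  qed
qed

end

section \<open>Diagonal matrices\<close>

lemma mat_diag_index: "i < n \<Longrightarrow> j < n \<Longrightarrow> mat_diag n f $$ (i, j) = (if i = j then f j else 0)"
  by (simp add: mat_diag_def)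

lemma mat_diag_cong_iff: "mat_diag n f = mat_diag n g \<longleftrightarrow> (\<forall>i<n. f i = g i)"
proof
  assume eq: "mat_diag n f = mat_diag n g"
  show "\<forall>i<n. f i = g i"
  proof (intro allI impI)
    fix i assume "i < n"
    then show "f i = g i"
      using arg_cong[OF eq, of "\<lambda>A. A $$ (i, i)"] by (simp add: mat_diag_index)
  qed
qed (auto simp: mat_diag_def intro!: eq_matI)

lemma mat_diag_add: "mat_diag n f + mat_diag n g = mat_diag n (\<lambda>i. f i + g i :: 'a::monoid_add)"
  by (rule eq_matI) (auto simp: mat_diag_def)

lemma mat_diag_uminus: "- mat_diag n f = mat_diag n (\<lambda>i. - f i :: 'a::group_add)"
  by (rule eq_matI) (auto simp: mat_diag_def)

lemma mat_diag_pow: "mat_diag n f ^\<^sub>m k = mat_diag n (\<lambda>i. f i ^ k :: 'a::comm_ring_1)"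
proof (induction k)
  case 0
  have "dim_row (mat_diag n f) = n" by (simp add: mat_diag_def)
  then show ?case by simp
next
  case (Suc k)
  then show ?case by (simp add: mat_diag_diag mult.commute)
qed

lemma mat_eval_diag: "mat_eval x (mat_diag n f) = mat_diag n (\<lambda>i. peval x (f i))"
  by (rule eq_matI) (auto simp: mat_diag_def)

lemma diag_mats_over_iff: "S \<in> diag_mats_over n T \<longleftrightarrow> (\<exists>s. (\<forall>i<n. s i \<in> T) \<and> S = mat_diag n s)"
proof
  assume S: "S \<in> diag_mats_over n T"
  have "S = mat_diag n (\<lambda>i. S $$ (i, i))"
    by (rule eq_matI) (use S in \<open>auto simp: diag_mats_over_def diagonal_mat_def mat_diag_def\<close>)
  with S show "\<exists>s. (\<forall>i<n. s i \<in> T) \<and> S = mat_diag n s"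
    by (intro exI[of _ "\<lambda>i. S $$ (i, i)"]) (auto simp: diag_mats_over_def)
next
  assume "\<exists>s. (\<forall>i<n. s i \<in> T) \<and> S = mat_diag n s"
  then show "S \<in> diag_mats_over n T"
    by (auto simp: diag_mats_over_def diagonal_mat_def mat_diag_def)
qed

lemma diag_mats_overI: "(\<And>i. i < n \<Longrightarrow> s i \<in> T) \<Longrightarrow> mat_diag n s \<in> diag_mats_over n T"
  unfolding diag_mats_over_iff by (intro exI[of _ s]) simp

lemma quadratic_form_diag:
  assumes "v \<in> carrier_vec n"
  shows "v \<bullet> (mat_diag n a *\<^sub>v v) = (\<Sum>i<n. a i * (v $ i)\<^sup>2 :: real)"
proof -
  have "(mat_diag n a *\<^sub>v v) $ i = a i * v $ i" if "i < n" for i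
  proof -
    have "(mat_diag n a *\<^sub>v v) $ i = (\<Sum>j<n. (if i = j then a j else 0) * v $ j)"
      using that assms by (simp add: mat_diag_def scalar_prod_def atLeast0LessThan)
    also have "\<dots> = (\<Sum>j<n. if j = i then a i * v $ i else 0)"
      by (intro sum.cong) auto
    finally show ?thesis using that by simp
  qed
  then show ?thesis
    using assms by (simp add: scalar_prod_def atLeast0LessThan power2_eq_square algebra_simps mat_diag_def)
qed

lemma sym_mat_diag: "mat_diag n a \<in> sym_mats n"
  unfolding sym_mats_def by (auto simp: mat_diag_def intro!: eq_matI)

lemma quadratic_form_diag_unit:
  assumes "i < n"
  shows "unit_vec n i \<bullet> (mat_diag n a *\<^sub>v unit_vec n i) = (a i :: real)"
proof -
  have "(\<Sum>j<n. a j * (unit_vec n i $ j)\<^sup>2) = (\<Sum>j<n. if j = i then a i else 0)"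
    using assms by (intro sum.cong) auto
  then show ?thesis using assms by (simp add: quadratic_form_diag)
qed

lemma psd_mat_diag: "psd_mat n (mat_diag n a) \<longleftrightarrow> (\<forall>i<n. 0 \<le> a i)"
proof
  assume psd: "psd_mat n (mat_diag n a)"
  show "\<forall>i<n. 0 \<le> a i"
  proof (intro allI impI)
    fix i assume i: "i < n"
    have "0 \<le> unit_vec n i \<bullet> (mat_diag n a *\<^sub>v unit_vec n i)"
      using psd unit_vec_carrier unfolding psd_mat_def by blast
    then show "0 \<le> a i" unfolding quadratic_form_diag_unit[OF i] .
  qed
next
  assume "\<forall>i<n. 0 \<le> a i"
  then show "psd_mat n (mat_diag n a)"
    by (auto simp: psd_mat_def sym_mat_diag quadratic_form_diag intro!: sum_nonneg)
qed

lemma pd_mat_diag: "pd_mat n (mat_diag n a) \<longleftrightarrow> (\<forall>i<n. 0 < a i)"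
proof
  assume pd: "pd_mat n (mat_diag n a)"
  show "\<forall>i<n. 0 < a i"
  proof (intro allI impI)
    fix i assume i: "i < n"
    then have "unit_vec n i \<noteq> (0\<^sub>v n :: real vec)" by (rule unit_vec_nonzero)
    with pd have "0 < unit_vec n i \<bullet> (mat_diag n a *\<^sub>v unit_vec n i)" using unit_vec_carrier unfolding pd_mat_def by blast
    then show "0 < a i" unfolding quadratic_form_diag_unit[OF i] .
  qed
next
  assume a: "\<forall>i<n. 0 < a i"
  have "0 < (\<Sum>i<n. a i * (v $ i)\<^sup>2)" if v: "v \<in> carrier_vec n" "v \<noteq> 0\<^sub>v n" for v :: "real vec"
  proof -
    obtain i where i: "i < n" "v $ i \<noteq> 0"
    proof (rule ccontr)
      assume "\<not> thesis"
      then have "\<forall>i<n. v $ i = 0" using that by blast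
      then have "v = 0\<^sub>v n" using v(1) by (intro eq_vecI) auto
      with v(2) show False by simp
    qed
    show ?thesis
      using a i by (intro sum_pos2[of _ i]) (auto simp: less_imp_le)
  qed
  then show "pd_mat n (mat_diag n a)"
    by (simp add: pd_mat_def sym_mat_diag quadratic_form_diag)
qed

text \<open>A diagonal entry of \<open>A\<^sup>T * A\<close> is the sum of the squares of a column
  of A.\<close>

lemma qm_power_diagonal:
  assumes T: "preordering T" and A: "A \<in> qm_power T n" and i: "i < n"
  shows "A $$ (i, i) \<in> T"
proof -
  obtain ps where ps: "set ps \<subseteq> T \<times> carrier_mat n n"
    and A: "A = foldr (\<lambda>(m, A) B. m \<cdot>\<^sub>m (A\<^sup>T * A) + B) ps (0\<^sub>m n n)"
    using A unfolding qm_power_def by blast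
  have "foldr (\<lambda>(m, A) B. m \<cdot>\<^sub>m (A\<^sup>T * A) + B) ps (0\<^sub>m n n) \<in> carrier_mat n n \<and>
    foldr (\<lambda>(m, A) B. m \<cdot>\<^sub>m (A\<^sup>T * A) + B) ps (0\<^sub>m n n) $$ (i, i) \<in> T"
    using ps
  proof (induction ps)
    case Nil
    then show ?case using i T by (simp add: preordering_0)
  next
    case (Cons p ps)
    obtain m M where p: "p = (m, M)" by fastforce
    have m: "m \<in> T" and M: "M \<in> carrier_mat n n" using Cons.prems p by auto
    define B where "B = foldr (\<lambda>(m, A) B. m \<cdot>\<^sub>m (A\<^sup>T * A) + B) ps (0\<^sub>m n n)"
    have B: "B \<in> carrier_mat n n" "B $$ (i, i) \<in> T" using Cons by (auto simp: B_def)
    have "(M\<^sup>T * M) $$ (i, i) = (\<Sum>k<n. (M $$ (k, i))\<^sup>2)"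
      using M i by (simp add: scalar_prod_def power2_eq_square atLeast0LessThan)
    moreover have "(\<Sum>k\<in>I. (M $$ (k, i))\<^sup>2) \<in> T" for I :: "nat set"
      by (induction I rule: infinite_finite_induct)
        (auto simp: preordering_0[OF T] intro!: preordering_add[OF T] preordering_square[OF T])
    ultimately have "m * (M\<^sup>T * M) $$ (i, i) \<in> T" using preordering_mult[OF T m] by simp
    then have "(m \<cdot>\<^sub>m (M\<^sup>T * M) + B) $$ (i, i) \<in> T"
      using M B i preordering_add[OF T] by simp
    then show ?case using M B by (simp add: p B_def[symmetric])
  qed
  then show ?thesis by (simp add: A)
qed

text \<open>The diagonal matrix units satisfy \<open>(E i)\<^sup>T * E i = E i\<close>, so the
  matrix is the sum of the t i times these products.\<close>

lemma diag_in_qm_power: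
  assumes "\<And>i. i < n \<Longrightarrow> t i \<in> T"
  shows "mat_diag n t \<in> qm_power T n"
proof -
  define E where "E i = mat_diag n (\<lambda>j. if j = i then 1 else 0 :: 'a)" for i
  define ps where "ps = map (\<lambda>i. (t i, E i)) [0..<n]"
  have E: "(E i)\<^sup>T * E i = E i" for i
  proof -
    have "(E i)\<^sup>T = E i" by (auto simp: E_def mat_diag_def intro!: eq_matI)
    then show ?thesis by (simp add: E_def mat_diag_diag) (simp add: mat_diag_cong_iff)
  qed
  have "foldr (\<lambda>(m, A) B. m \<cdot>\<^sub>m (A\<^sup>T * A) + B) (map (\<lambda>i. (t i, E i)) ns) (0\<^sub>m n n) =
    mat_diag n (\<lambda>j. \<Sum>i\<leftarrow>ns. if j = i then t i else 0)" for ns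
  proof (induction ns)
    case Nil
    show ?case by (rule eq_matI) (auto simp: mat_diag_def)
  next
    case (Cons i ns)
    have "t i \<cdot>\<^sub>m E i = mat_diag n (\<lambda>j. if j = i then t i else 0)"
      by (rule eq_matI) (auto simp: E_def mat_diag_def)
    then show ?case using Cons by (simp add: E mat_diag_add)
  qed
  then have "foldr (\<lambda>(m, A) B. m \<cdot>\<^sub>m (A\<^sup>T * A) + B) ps (0\<^sub>m n n) = mat_diag n t"
    by (simp add: ps_def mat_diag_cong_iff interv_sum_list_conv_sum_set_nat)
  moreover have "set ps \<subseteq> T \<times> carrier_mat n n"
    using assms by (auto simp: ps_def E_def)
  ultimately show ?thesis unfolding qm_power_def by (intro CollectI exI[of _ ps]) simp
qed

lemma diag_in_qm_power_iff:
  assumes "preordering T"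
  shows "mat_diag n t \<in> qm_power T n \<longleftrightarrow> (\<forall>i<n. t i \<in> T)"
proof
  assume t: "mat_diag n t \<in> qm_power T n"
  show "\<forall>i<n. t i \<in> T"
    using qm_power_diagonal[OF assms t] by (simp add: mat_diag_index)
qed (rule diag_in_qm_power, simp)

text \<open>Covers the identity (u = 1) and even powers (u i = d i ^ (2 * m)). Diagonal matrices
  commute, so the two matrix equations amount to one scalar equation per entry.\<close>

lemma diag_certificate_iff:
  fixes d u :: "nat \<Rightarrow> 'a::comm_ring_1"
  shows "(\<exists>S\<in>diag_mats_over n P. \<exists>T\<in>diag_mats_over n P.
      S * mat_diag n d = mat_diag n u + T \<and> mat_diag n d * S = mat_diag n u + T) \<longleftrightarrow>
    (\<forall>i<n. \<exists>s\<in>P. \<exists>t\<in>P. s * d i = u i + t)" (is "?L \<longleftrightarrow> ?R")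
proof
  assume ?L
  then obtain s t where "\<forall>i<n. s i \<in> P" "\<forall>i<n. t i \<in> P"
    "mat_diag n s * mat_diag n d = mat_diag n u + mat_diag n t"
    unfolding Bex_def diag_mats_over_iff by blast
  moreover from this have "\<forall>i<n. s i * d i = u i + t i"
    by (simp add: mat_diag_diag mat_diag_add mat_diag_cong_iff)
  ultimately show ?R by blast
next
  assume ?R
  have "\<exists>st. i < n \<longrightarrow> fst st \<in> P \<and> snd st \<in> P \<and> fst st * d i = u i + snd st" for i
  proof (cases "i < n")
    case True
    with \<open>?R\<close> obtain s t where "s \<in> P" "t \<in> P" "s * d i = u i + t" by blast
    then show ?thesis by (intro exI[of _ "(s, t)"]) simp
  qed simp
  then have "\<forall>i. \<exists>st. i < n \<longrightarrow> fst st \<in> P \<and> snd st \<in> P \<and> fst st * d i = u i + snd st" ..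
  from choice[OF this] obtain st where st: "\<forall>i. i < n \<longrightarrow> fst (st i) \<in> P \<and> snd (st i) \<in> P \<and>
    fst (st i) * d i = u i + snd (st i)" by (rule exE)
  let ?S = "mat_diag n (\<lambda>i. fst (st i))" and ?T = "mat_diag n (\<lambda>i. snd (st i))"
  have "?S \<in> diag_mats_over n P" "?T \<in> diag_mats_over n P"
    using st by (intro diag_mats_overI; simp)+
  moreover have "?S * mat_diag n d = mat_diag n u + ?T"
    using st by (simp add: mat_diag_diag mat_diag_add mat_diag_cong_iff)
  moreover have "mat_diag n d * ?S = ?S * mat_diag n d"
    by (simp add: mat_diag_diag mult.commute)
  ultimately have "\<exists>T\<in>diag_mats_over n P.
      ?S * mat_diag n d = mat_diag n u + T \<and> mat_diag n d * ?S = mat_diag n u + T"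
    by (intro bexI[of _ ?T] conjI) simp_all
  with \<open>?S \<in> diag_mats_over n P\<close> show ?L by (rule bexI[rotated])
qed

theorem proposition3p1:
  fixes n :: nat
    and \<G> :: "'d::finite rpoly mat set"
    and G :: "'d rpoly set"
    and ds :: "'d rpoly list"
    and D :: "'d rpoly mat"
  assumes "n \<ge> 1"
    and "finite \<G>" and "\<G> \<subseteq> sym_mats n"
    and "finite G"
    and "K_mat n \<G> = K_set G"
    and "qm_power (preordering_gen G) n \<subseteq> mat_preordering_gen n \<G>"
    and "length ds \<le> n" and "D = diag_of n ds"
  shows "((\<forall>x\<in>K_mat n \<G>. pd_mat n (mat_eval x D)) \<longleftrightarrow>
       (\<exists>S\<in>diag_mats_over n (preordering_gen G). \<exists>T\<in>diag_mats_over n (preordering_gen G).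
          S * D = 1\<^sub>m n + T \<and> D * S = 1\<^sub>m n + T)) \<and>
    ((\<forall>x\<in>K_mat n \<G>. psd_mat n (mat_eval x D)) \<longleftrightarrow>
       (\<exists>m::nat. \<exists>S\<in>diag_mats_over n (preordering_gen G). \<exists>T\<in>diag_mats_over n (preordering_gen G).
          S * D = D ^\<^sub>m (2 * m) + T \<and> D * S = D ^\<^sub>m (2 * m) + T)) \<and>
    ((\<forall>x\<in>K_mat n \<G>. mat_eval x D = 0\<^sub>m n n) \<longleftrightarrow>
       (\<exists>m::nat. - (D ^\<^sub>m (2 * m)) \<in> qm_power (preordering_gen G) n)) \<and>
    (K_mat n \<G> = {} \<longleftrightarrow> - 1\<^sub>m n \<in> qm_power (preordering_gen G) n)"
proof -
  \<comment> \<open>The zeros beyond r count as diagonal entries and are certified like the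
    others.\<close>
  define d where "d = (\<lambda>i. if i < length ds then ds ! i else 0)"
  have D: "D = mat_diag n d" using assms by (simp add: diag_of_def d_def)
  define P where "P = preordering_gen G"
  have P: "preordering P" unfolding P_def by (rule preordering_gen)
  note fin = \<open>finite G\<close> and K = \<open>K_mat n \<G> = K_set G\<close>
  note closed = preordering_mult[OF P] preordering_even_power[OF P]

  have 1: "(\<forall>x\<in>K_mat n \<G>. pd_mat n (mat_eval x D)) \<longleftrightarrow>
    (\<exists>S\<in>diag_mats_over n P. \<exists>T\<in>diag_mats_over n P. S * D = 1\<^sub>m n + T \<and> D * S = 1\<^sub>m n + T)"
  proof -
    have "(\<forall>x\<in>K_mat n \<G>. pd_mat n (mat_eval x D)) \<longleftrightarrow> (\<forall>i<n. \<forall>x\<in>K_set G. 0 < peval x (d i))"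
      unfolding K D mat_eval_diag pd_mat_diag by blast
    also have "\<dots> \<longleftrightarrow> (\<forall>i<n. \<exists>s\<in>P. \<exists>t\<in>P. s * d i = 1 + t)"
      unfolding pos_on_K_set_iff[OF fin] P_def ..
    also have "\<dots> \<longleftrightarrow> (\<exists>S\<in>diag_mats_over n P. \<exists>T\<in>diag_mats_over n P. S * D = 1\<^sub>m n + T \<and> D * S = 1\<^sub>m n + T)"
      unfolding D mat_diag_one[symmetric] diag_certificate_iff ..
    finally show ?thesis .
  qed

  have 2: "(\<forall>x\<in>K_mat n \<G>. psd_mat n (mat_eval x D)) \<longleftrightarrow>
    (\<exists>m. \<exists>S\<in>diag_mats_over n P. \<exists>T\<in>diag_mats_over n P. S * D = D ^\<^sub>m (2 * m) + T \<and> D * S = D ^\<^sub>m (2 * m) + T)"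
  proof -
    have "(\<forall>x\<in>K_mat n \<G>. psd_mat n (mat_eval x D)) \<longleftrightarrow> (\<forall>i<n. \<forall>x\<in>K_set G. 0 \<le> peval x (d i))"
      unfolding K D mat_eval_diag psd_mat_diag by blast
    also have "\<dots> \<longleftrightarrow> (\<forall>i<n. \<exists>m. \<exists>s\<in>P. \<exists>t\<in>P. s * d i = d i ^ (2 * m) + t)"
      unfolding nonneg_on_K_set_iff[OF fin] P_def ..
    also have "\<dots> \<longleftrightarrow> (\<exists>m. \<forall>i<n. \<exists>s\<in>P. \<exists>t\<in>P. s * d i = d i ^ (2 * m) + t)"
    proof
      assume "\<forall>i<n. \<exists>m. \<exists>s\<in>P. \<exists>t\<in>P. s * d i = d i ^ (2 * m) + t"
      then have "\<forall>i. \<exists>m. i < n \<longrightarrow> (\<exists>s\<in>P. \<exists>t\<in>P. s * d i = d i ^ (2 * m) + t)" by blast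
      from choice[OF this] obtain m where
        m: "\<forall>i. i < n \<longrightarrow> (\<exists>s\<in>P. \<exists>t\<in>P. s * d i = d i ^ (2 * m i) + t)" by (rule exE)
      \<comment> \<open>The sum of the individual exponents is a common one. An equation is lifted
        to it by multiplying with the even power d i ^ (2 * k), under which s and t stay in
        P.\<close>
      have "\<exists>s\<in>P. \<exists>t\<in>P. s * d i = d i ^ (2 * (\<Sum>i<n. m i)) + t" if i: "i < n" for i
      proof -
        obtain s t where st: "s \<in> P" "t \<in> P" "s * d i = d i ^ (2 * m i) + t" using m i by blast
        have "m i \<le> (\<Sum>i<n. m i)" using i by (intro member_le_sum) auto
        then obtain k where k: "(\<Sum>i<n. m i) = m i + k" using le_Suc_ex by blast
        have "(s * d i ^ (2 * k)) * d i = (s * d i) * d i ^ (2 * k)" by (simp add: ac_simps)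
        also have "\<dots> = d i ^ (2 * (\<Sum>i<n. m i)) + t * d i ^ (2 * k)"
          unfolding st(3) k by (simp add: distrib_left distrib_right power_add)
        finally show ?thesis using closed(1)[OF st(1) closed(2)] closed(1)[OF st(2) closed(2)] by blast
      qed
      then show "\<exists>m. \<forall>i<n. \<exists>s\<in>P. \<exists>t\<in>P. s * d i = d i ^ (2 * m) + t" by blast
    qed blast
    also have "\<dots> \<longleftrightarrow> (\<exists>m. \<exists>S\<in>diag_mats_over n P. \<exists>T\<in>diag_mats_over n P.
        S * D = D ^\<^sub>m (2 * m) + T \<and> D * S = D ^\<^sub>m (2 * m) + T)"
      unfolding D mat_diag_pow diag_certificate_iff ..
    finally show ?thesis .
  qed

  have 3: "(\<forall>x\<in>K_mat n \<G>. mat_eval x D = 0\<^sub>m n n) \<longleftrightarrow> (\<exists>m. - (D ^\<^sub>m (2 * m)) \<in> qm_power P n)"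
  proof -
    have "0\<^sub>m n n = mat_diag n (\<lambda>_. 0 :: real)" by (rule eq_matI) (auto simp: mat_diag_def)
    then have "(\<forall>x\<in>K_mat n \<G>. mat_eval x D = 0\<^sub>m n n) \<longleftrightarrow> (\<forall>i<n. \<forall>x\<in>K_set G. peval x (d i) = 0)"
      unfolding K D mat_eval_diag by (auto simp: mat_diag_cong_iff)
    also have "\<dots> \<longleftrightarrow> (\<forall>i<n. \<exists>m. - (d i ^ (2 * m)) \<in> P)"
      unfolding zero_on_K_set_iff[OF fin] P_def ..
    also have "\<dots> \<longleftrightarrow> (\<exists>m. \<forall>i<n. - (d i ^ (2 * m)) \<in> P)"
    proof
      assume "\<forall>i<n. \<exists>m. - (d i ^ (2 * m)) \<in> P"
      then have "\<forall>i. \<exists>m. i < n \<longrightarrow> - (d i ^ (2 * m)) \<in> P" by blast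
      from choice[OF this] obtain m where m: "\<forall>i. i < n \<longrightarrow> - (d i ^ (2 * m i)) \<in> P" by (rule exE)
      have "- (d i ^ (2 * (\<Sum>i<n. m i))) \<in> P" if i: "i < n" for i
      proof -
        have "m i \<le> (\<Sum>i<n. m i)" using i by (intro member_le_sum) auto
        then obtain k where k: "(\<Sum>i<n. m i) = m i + k" using le_Suc_ex by blast
        have "- (d i ^ (2 * m i)) * d i ^ (2 * k) \<in> P" by (rule closed(1)[OF m[rule_format, OF i] closed(2)])
        then show ?thesis unfolding k by (simp add: distrib_left power_add)
      qed
      then show "\<exists>m. \<forall>i<n. - (d i ^ (2 * m)) \<in> P" by blast
    qed blast
    also have "\<dots> \<longleftrightarrow> (\<exists>m. - (D ^\<^sub>m (2 * m)) \<in> qm_power P n)"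
      unfolding D mat_diag_pow mat_diag_uminus diag_in_qm_power_iff[OF P] ..
    finally show ?thesis .
  qed

  have 4: "K_mat n \<G> = {} \<longleftrightarrow> - 1\<^sub>m n \<in> qm_power P n"
  proof -
    have "K_mat n \<G> = {} \<longleftrightarrow> (\<forall>x\<in>K_set G. peval x 1 = 0)"
      unfolding K by (auto simp: peval_simps)
    also have "\<dots> \<longleftrightarrow> - 1 \<in> P"
      unfolding zero_on_K_set_iff[OF fin] P_def by simp
    \<comment> \<open>At least one diagonal entry must exist for the entrywise condition to say
      anything.\<close>
    also have "\<dots> \<longleftrightarrow> (\<forall>i<n. - 1 \<in> P)" using \<open>n \<ge> 1\<close> by (auto dest: spec[of _ 0])
    also have "\<dots> \<longleftrightarrow> - 1\<^sub>m n \<in> qm_power P n"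
      unfolding mat_diag_one[symmetric] mat_diag_uminus diag_in_qm_power_iff[OF P] ..
    finally show ?thesis .
  qed

  from 1 2 3 4 show ?thesis unfolding P_def by blast
qed

end
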